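(* For every language $L$ (over a finite alphabet), there exists a language $L'$ over the alphabet $\{a,b\}$ such that $L'$ is Turing equivalent to $L$ (each is Turing reducible to the other), and there exists a 2qcfa which recognizes $L'$ with bounded error in polynomial expected time.
   Context: A two-way finite automaton with quantum and classical states (2qcfa) has a finite set of classical states (with designated initial, accepting and rejecting states), a quantum register with a finite set of $j$ quantum basis states and a designated initial quantum state, and a read-only input tape holding the input string between a left and a right end-marker, scanned by a two-way head. Each step has two parts: first, a superoperator $\mathcal{E}=\{E_1,\dots,E_k\}$ (a finite list of $j\times j$ matrices with $\sum_i E_i^\dagger E_i=I$), determined by the current classical state and the scanned tape symbol, is applied to the quantum register in state $|\psi\rangle$: outcome $i$ is observed with probability $p_i=\|E_i|\psi\rangle\|^2$, and the register becomes $E_i|\psi\rangle/\sqrt{p_i}$; second, the next classical state and the head movement (left, stay, right) are determined by the current classical state, the scanned symbol and the observed outcome. The machine halts when it enters an accepting or rejecting classical state. The entries of the operation elements (transition amplitudes) may be arbitrary real numbers, possibly uncomputable. A 2qcfa recognizes a language $L'$ with bounded error if there is $\epsilon<1/2$ such that every $w\in L'$ is accepted with probability at least $1-\epsilon$ and every $w\notin L'$ is rejected with probability at least $1-\epsilon$; it runs in polynomial expected time if the expected number of steps on inputs of length $n$ is bounded by a polynomial in $n$. *)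

theory Defs
  imports
    "HOL-Probability.Probability_Mass_Function"
    "HOL-Library.Countable"
    "HOL-Library.Nat_Bijection"
    "HOL-Computational_Algebra.Polynomial"
    "Jordan_Normal_Form.Schur_Decomposition"
begin

section \<open>Turing reducibility\<close>

text \<open>
  A language \<open>A\<close> is Turing reducible to \<open>B\<close> if (the characteristic function of) \<open>A\<close> is recursive
  in \<open>B\<close>: it is computed by a program built from the basic functions and an oracle for \<open>B\<close> by
  composition, primitive recursion and (unbounded, possibly diverging) minimisation.  Programs are
  finite syntactic objects; their partial input-output behaviour relative to an oracle \<open>X\<close> is
  given by a big-step relation.
\<close>

datatype orec =
    Zero
  | Succ
  | Proj nat
  | Oracle
  | Comp orec "orec list"
  | PrimRec orec orec
  | Mu orec

inductive computes :: "nat set \<Rightarrow> orec \<Rightarrow> nat list \<Rightarrow> nat \<Rightarrow> bool" for X :: "nat set" where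
  computes_Zero: "computes X Zero xs 0"
| computes_Succ: "computes X Succ [x] (Suc x)"
| computes_Proj: "i < length xs \<Longrightarrow> computes X (Proj i) xs (xs ! i)"
| computes_Oracle: "computes X Oracle [x] (if x \<in> X then 1 else 0)"
| computes_Comp:
    "list_all2 (\<lambda>g y. computes X g xs y) gs ys \<Longrightarrow> computes X f ys z
      \<Longrightarrow> computes X (Comp f gs) xs z"
| computes_PrimRec_0: "computes X f xs y \<Longrightarrow> computes X (PrimRec f g) (0 # xs) y"
| computes_PrimRec_Suc:
    "computes X (PrimRec f g) (n # xs) y \<Longrightarrow> computes X g (n # y # xs) z
      \<Longrightarrow> computes X (PrimRec f g) (Suc n # xs) z"
| computes_Mu:
    "computes X f (n # xs) 0 \<Longrightarrow> (\<forall>m<n. \<exists>y. computes X f (m # xs) (Suc y))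
      \<Longrightarrow> computes X (Mu f) xs n"

lemma computes_deterministic:
  "computes X p xs y \<Longrightarrow> computes X p xs z \<Longrightarrow> y = z"
proof (induction arbitrary: z rule: computes.induct)
  case (computes_Comp xs gs ys f u)
  from computes_Comp.prems obtain ys' where
    ys': "list_all2 (\<lambda>g y. computes X g xs y) gs ys'" "computes X f ys' z"
    by (cases rule: computes.cases) auto
  have "ys = ys'"
  proof (rule nth_equalityI)
    show len: "length ys = length ys'"
      using computes_Comp(1) ys'(1) by (auto dest!: list_all2_lengthD)
    fix i assume i: "i < length ys"
    have "\<forall>u. computes X (gs ! i) xs u \<longrightarrow> ys ! i = u"
      using list_all2_nthD2[OF computes_Comp(1) i] by blast
    moreover have "computes X (gs ! i) xs (ys' ! i)"
      using list_all2_nthD2[OF ys'(1)] i len by simp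
    ultimately show "ys ! i = ys' ! i" by blast
  qed
  then show ?case using computes_Comp.IH ys'(2) by blast
next
  case (computes_PrimRec_0 f xs y g)
  from computes_PrimRec_0.prems show ?case
    by (cases rule: computes.cases) (auto intro: computes_PrimRec_0.IH)
next
  case (computes_PrimRec_Suc f g n xs y u)
  from computes_PrimRec_Suc.prems obtain y' where
    "computes X (PrimRec f g) (n # xs) y'" "computes X g (n # y' # xs) z"
    by (cases rule: computes.cases) auto
  then show ?case using computes_PrimRec_Suc.IH by blast
next
  case (computes_Mu f n xs)
  from computes_Mu.prems have z: "computes X f (z # xs) 0"
      "\<forall>m<z. \<exists>y. computes X f (m # xs) (Suc y)"
    by (cases rule: computes.cases; auto)+
  show ?case
  proof (cases n z rule: linorder_cases)
    case less
    then obtain y where "computes X f (n # xs) (Suc y)" using z(2) by blast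
    then show ?thesis using computes_Mu.IH(1) by blast
  next
    case greater
    then obtain y where "\<forall>u. computes X f (z # xs) u \<longrightarrow> Suc y = u"
      using computes_Mu.IH(2) by blast
    then show ?thesis using z(1) by blast
  qed
qed (erule computes.cases; simp)+

text \<open>
  Words over a finite alphabet are coded by natural numbers.  Here \<open>to_nat\<close> is some injective
  numbering of the letters; as the alphabet is finite, any two such numberings differ by a
  computable translation, so the choice does not affect reducibility.
\<close>

definition word_code :: "'a::finite list \<Rightarrow> nat" where
  "word_code w = list_encode (map to_nat w)"

definition turing_reducible :: "'a::finite list set \<Rightarrow> 'b::finite list set \<Rightarrow> bool" where
  "turing_reducible A B \<longleftrightarrow>
     (\<exists>p. \<forall>w. computes (word_code ` B) p [word_code w] (if w \<in> A then 1 else 0))"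

definition turing_equivalent :: "'a::finite list set \<Rightarrow> 'b::finite list set \<Rightarrow> bool" where
  "turing_equivalent A B \<longleftrightarrow> turing_reducible A B \<and> turing_reducible B A"


section \<open>Two-way finite automata with quantum and classical states\<close>

definition vec_norm2 :: "complex Matrix.vec \<Rightarrow> real" where
  "vec_norm2 v = (\<Sum>i<dim_vec v. (cmod (vec_index v i))\<^sup>2)"

definition superoperator :: "nat \<Rightarrow> complex mat list \<Rightarrow> bool" where
  "superoperator d Es \<longleftrightarrow>
     set Es \<subseteq> carrier_mat d d \<and>
     foldr (+) (map (\<lambda>E. mat_adjoint E * E) Es) (0\<^sub>m d d) = 1\<^sub>m d"

datatype 'a tape_symbol = LeftEnd | RightEnd | Letter 'a

datatype move = MoveLeft | Stay | MoveRight

text \<open>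
  The classical states are the numbers below \<open>num_states\<close>; the quantum basis states are the
  numbers below \<open>qdim\<close>.  \<open>qop\<close> gives the superoperator applied in a classical state on a scanned
  symbol, and \<open>trans\<close> the next classical state and head movement, which depend in addition on the
  (index of the) observed outcome.
\<close>

record 'a qcfa =
  num_states :: nat
  init_state :: nat
  acc_states :: "nat set"
  rej_states :: "nat set"
  qdim :: nat
  init_qstate :: nat
  qop :: "nat \<Rightarrow> 'a tape_symbol \<Rightarrow> complex mat list"
  trans :: "nat \<Rightarrow> 'a tape_symbol \<Rightarrow> nat \<Rightarrow> nat \<times> move"

definition halting :: "'a qcfa \<Rightarrow> nat set" where
  "halting M = acc_states M \<union> rej_states M"

text \<open>
  The amplitudes are arbitrary real numbers.  The last two conditions keep the head on the part of
  the tape delimited by the end-markers.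
\<close>

definition is_2qcfa :: "'a qcfa \<Rightarrow> bool" where
  "is_2qcfa M \<longleftrightarrow>
     init_state M < num_states M \<and>
     acc_states M \<subseteq> {..<num_states M} \<and>
     rej_states M \<subseteq> {..<num_states M} \<and>
     acc_states M \<inter> rej_states M = {} \<and>
     init_qstate M < qdim M \<and>
     (\<forall>s<num_states M. s \<notin> halting M \<longrightarrow>
        (\<forall>\<sigma>. superoperator (qdim M) (qop M s \<sigma>) \<and>
             (\<forall>E\<in>set (qop M s \<sigma>). elements_mat E \<subseteq> \<real>) \<and>
             (\<forall>i<length (qop M s \<sigma>). fst (trans M s \<sigma> i) < num_states M)) \<and>
        (\<forall>i<length (qop M s LeftEnd). snd (trans M s LeftEnd i) \<noteq> MoveLeft) \<and>
        (\<forall>i<length (qop M s RightEnd). snd (trans M s RightEnd i) \<noteq> MoveRight))"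

text \<open>
  A configuration consists of the classical state, the head position and the state of the quantum
  register.  Position \<open>0\<close> carries the left end-marker and position \<open>length w + 1\<close> the right one.
\<close>

type_synonym config = "nat \<times> nat \<times> complex Matrix.vec"

definition tape :: "'a list \<Rightarrow> nat \<Rightarrow> 'a tape_symbol" where
  "tape w h = (if h = 0 then LeftEnd else if h \<le> length w then Letter (w ! (h - 1)) else RightEnd)"

fun move_head :: "move \<Rightarrow> nat \<Rightarrow> nat" where
  "move_head MoveLeft h = h - 1"
| "move_head Stay h = h"
| "move_head MoveRight h = h + 1"

definition init_config :: "'a qcfa \<Rightarrow> config" where
  "init_config M = (init_state M, 0, unit_vec (qdim M) (init_qstate M))"

definition outcome_pmf :: "complex mat list \<Rightarrow> complex Matrix.vec \<Rightarrow> nat pmf" where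
  "outcome_pmf Es \<psi> =
     embed_pmf (\<lambda>i. if i < length Es then vec_norm2 ((Es ! i) *\<^sub>v \<psi>) else 0)"

definition post_state :: "complex mat \<Rightarrow> complex Matrix.vec \<Rightarrow> complex Matrix.vec" where
  "post_state E \<psi> = complex_of_real (1 / sqrt (vec_norm2 (E *\<^sub>v \<psi>))) \<cdot>\<^sub>v (E *\<^sub>v \<psi>)"

text \<open>
  Applied to a unit vector, a superoperator yields a probability distribution on outcomes, and the
  register is again in a unit vector afterwards, so that the distributions below are well-defined.
\<close>

lemma complex_vec_norm2: "complex_of_real (vec_norm2 v) = v \<bullet>c v"
  by (simp add: vec_norm2_def scalar_prod_def atLeast0LessThan complex_norm_square del: of_real_power)

lemma adjoint_mult_scalar_prod:
  fixes E :: "complex mat"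
  assumes E: "E \<in> carrier_mat d d" and v: "v \<in> carrier_vec d"
  shows "((mat_adjoint E * E) *\<^sub>v v) \<bullet>c v = (E *\<^sub>v v) \<bullet>c (E *\<^sub>v v)"
proof -
  have A: "mat_adjoint E \<in> carrier_mat d d"
    using E by (auto simp: mat_adjoint_def)
  have Ai: "mat_adjoint E $$ (i, k) = cnj (E $$ (k, i))" if "i < d" "k < d" for i k
    using E that by (simp add: mat_adjoint_def mat_of_rows_def)
  define u where "u = E *\<^sub>v v"
  have u: "u \<in> carrier_vec d" using E v by (simp add: u_def)
  have "(mat_adjoint E * E) *\<^sub>v v = mat_adjoint E *\<^sub>v u"
    unfolding u_def using A E v by (rule assoc_mult_mat_vec)
  moreover have "(mat_adjoint E *\<^sub>v u) \<bullet>c v =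
      (\<Sum>i<d. (\<Sum>k<d. cnj (E $$ (k, i)) * vec_index u k) * cnj (vec_index v i))"
    using A E u v by (simp add: scalar_prod_def atLeast0LessThan Ai)
  moreover have "\<dots> = (\<Sum>k<d. vec_index u k * cnj (\<Sum>i<d. E $$ (k, i) * vec_index v i))"
    by (simp add: sum_distrib_left sum_distrib_right cnj_sum mult_ac)
       (rule sum.swap)
  moreover have "\<dots> = u \<bullet>c u"
    unfolding u_def using E v by (simp add: scalar_prod_def atLeast0LessThan)
  ultimately show ?thesis by (simp add: u_def)
qed

lemma superoperator_probs_sum:
  assumes "superoperator d Es" and v: "v \<in> carrier_vec d"
  shows "(\<Sum>i<length Es. vec_norm2 ((Es ! i) *\<^sub>v v)) = vec_norm2 v"
proof -
  let ?S = "\<lambda>Es. foldr (+) (map (\<lambda>E. mat_adjoint E * E) Es) (0\<^sub>m d d)"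
  have *: "?S Es \<in> carrier_mat d d \<and>
      (?S Es *\<^sub>v v) \<bullet>c v = (\<Sum>E\<leftarrow>Es. (E *\<^sub>v v) \<bullet>c (E *\<^sub>v v))" if "set Es \<subseteq> carrier_mat d d" for Es
    using that
  proof (induction Es)
    case Nil
    then show ?case using v by (simp add: scalar_prod_def)
  next
    case (Cons E Es)
    then have E: "E \<in> carrier_mat d d" and IH: "?S Es \<in> carrier_mat d d"
      "(?S Es *\<^sub>v v) \<bullet>c v = (\<Sum>E\<leftarrow>Es. (E *\<^sub>v v) \<bullet>c (E *\<^sub>v v))" by auto
    have A: "mat_adjoint E * E \<in> carrier_mat d d"
      using E by (auto simp: mat_adjoint_def)
    have "((mat_adjoint E * E + ?S Es) *\<^sub>v v) \<bullet>c v
        = ((mat_adjoint E * E) *\<^sub>v v) \<bullet>c v + (?S Es *\<^sub>v v) \<bullet>c v"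
      using A IH(1) v
      by (subst add_mult_distrib_mat_vec[OF A IH(1) v], subst add_scalar_prod_distrib[of _ d]) auto
    then show ?case using A IH adjoint_mult_scalar_prod[OF E v] by simp
  qed
  have "complex_of_real (\<Sum>E\<leftarrow>Es. vec_norm2 (E *\<^sub>v v)) = (\<Sum>E\<leftarrow>Es. (E *\<^sub>v v) \<bullet>c (E *\<^sub>v v))"
    by (induction Es) (simp_all add: complex_vec_norm2)
  also have "\<dots> = v \<bullet>c v"
    using *[of Es] assms by (simp add: superoperator_def)
  finally have "(\<Sum>E\<leftarrow>Es. vec_norm2 (E *\<^sub>v v)) = vec_norm2 v"
    unfolding complex_vec_norm2[symmetric] of_real_eq_iff .
  then show ?thesis by (simp add: sum_list_sum_nth atLeast0LessThan)
qed

lemma vec_norm2_nonneg: "vec_norm2 v \<ge> 0"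
  by (simp add: vec_norm2_def sum_nonneg)

lemma pmf_outcome_pmf:
  assumes "superoperator d Es" "\<psi> \<in> carrier_vec d" "vec_norm2 \<psi> = 1"
  shows "pmf (outcome_pmf Es \<psi>) i = (if i < length Es then vec_norm2 ((Es ! i) *\<^sub>v \<psi>) else 0)"
proof -
  let ?f = "\<lambda>i. if i < length Es then vec_norm2 ((Es ! i) *\<^sub>v \<psi>) else 0"
  have "(\<integral>\<^sup>+i. ennreal (?f i) \<partial>count_space UNIV) = (\<Sum>i<length Es. ennreal (?f i))"
    by (rule nn_integral_count_space') (auto split: if_splits)
  also have "\<dots> = ennreal (\<Sum>i<length Es. ?f i)"
    by (rule sum_ennreal) (auto simp: vec_norm2_nonneg)
  also have "(\<Sum>i<length Es. ?f i) = 1"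
    using superoperator_probs_sum[OF assms(1,2)] assms(3) by simp
  finally show ?thesis
    unfolding outcome_pmf_def by (subst pmf_embed_pmf) (auto simp: vec_norm2_nonneg)
qed

lemma vec_norm2_post_state:
  assumes "vec_norm2 (E *\<^sub>v \<psi>) > 0"
  shows "vec_norm2 (post_state E \<psi>) = 1"
proof -
  have "vec_norm2 (complex_of_real c \<cdot>\<^sub>v v) = c\<^sup>2 * vec_norm2 v" for c v
    by (simp add: vec_norm2_def norm_mult power_mult_distrib sum_distrib_left)
  then show ?thesis using assms unfolding post_state_def by (simp add: power_divide del: of_real_divide)
qed

text \<open>Halting configurations are made absorbing.\<close>

definition step :: "'a qcfa \<Rightarrow> 'a list \<Rightarrow> config \<Rightarrow> config pmf" where
  "step M w = (\<lambda>(s, h, \<psi>).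
     if s \<in> halting M then return_pmf (s, h, \<psi>)
     else let \<sigma> = tape w h; Es = qop M s \<sigma> in
       map_pmf (\<lambda>i. case trans M s \<sigma> i of (s', m) \<Rightarrow>
                  (s', move_head m h, post_state (Es ! i) \<psi>))
         (outcome_pmf Es \<psi>))"

fun run :: "'a qcfa \<Rightarrow> 'a list \<Rightarrow> nat \<Rightarrow> config \<Rightarrow> config pmf" where
  "run M w 0 c = return_pmf c"
| "run M w (Suc t) c = bind_pmf (step M w c) (run M w t)"

definition state_prob :: "'a qcfa \<Rightarrow> 'a list \<Rightarrow> nat \<Rightarrow> nat set \<Rightarrow> real" where
  "state_prob M w t S = measure_pmf.prob (run M w t (init_config M)) {c. fst c \<in> S}"

text \<open>
  As halting configurations are absorbing, the probability of having accepted within \<open>t\<close> steps is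
  nondecreasing in \<open>t\<close>, and its supremum is the probability of ever accepting.
\<close>

definition accept_prob :: "'a qcfa \<Rightarrow> 'a list \<Rightarrow> real" where
  "accept_prob M w = (SUP t. state_prob M w t (acc_states M))"

definition reject_prob :: "'a qcfa \<Rightarrow> 'a list \<Rightarrow> real" where
  "reject_prob M w = (SUP t. state_prob M w t (rej_states M))"

text \<open>
  The number of steps of a computation is the number of times \<open>t\<close> at which it has not yet halted;
  its expectation is the sum over \<open>t\<close> of the probabilities of these events (possibly infinite).
\<close>

definition expected_steps :: "'a qcfa \<Rightarrow> 'a list \<Rightarrow> ennreal" where
  "expected_steps M w = (\<Sum>t. ennreal (state_prob M w t (- halting M)))"

definition recognizes_bounded_error :: "'a qcfa \<Rightarrow> 'a list set \<Rightarrow> bool" where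
  "recognizes_bounded_error M L \<longleftrightarrow>
     (\<exists>\<epsilon>::real. \<epsilon> < 1/2 \<and>
        (\<forall>w\<in>L. accept_prob M w \<ge> 1 - \<epsilon>) \<and>
        (\<forall>w. w \<notin> L \<longrightarrow> reject_prob M w \<ge> 1 - \<epsilon>))"

definition polynomial_expected_time :: "'a qcfa \<Rightarrow> bool" where
  "polynomial_expected_time M \<longleftrightarrow>
     (\<exists>p :: nat poly. \<forall>w. expected_steps M w \<le> of_nat (poly p (length w)))"


section \<open>The binary alphabet\<close>

datatype ab = Sym_a | Sym_b

instance ab :: finite
proof
  have "(UNIV :: ab set) = {Sym_a, Sym_b}"
    using ab.exhaust by auto
  then show "finite (UNIV :: ab set)"
    by (metis finite.emptyI finite.insertI)
qed

end

theory Submission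
  imports Defs
begin

text \<open>
  Let \<open>X\<close> be the set of codes of words in \<open>L\<close> and let \<open>L'\<close> consist of the words
  \<open>w\<^sub>k = a b a\<^sup>4 b \<dots> b a\<^sup>(4^k)\<close> with \<open>k \<in> X\<close>; since \<open>k\<close> and \<open>w\<^sub>k\<close> can be computed from each
  other, \<open>L'\<close> is Turing equivalent to \<open>L\<close>.  The digits in base 4 of an angle \<open>\<theta>\<close> store \<open>X\<close>: rotating
  \<open>4^k\<close> times by \<open>\<theta>\<close> shifts them so that only whole turns precede the \<open>k\<close>-th digit, and a
  measurement then tells whether \<open>k \<in> X\<close> with error at most 1/4.  It remains to reject the words that
  are not of the form \<open>w\<^sub>k\<close>.  As in the automaton of Ambainis and Watrous for equal numbers of letters,
  neighbouring blocks are compared by rotating by multiples of \<open>\<surd>2 \<pi>\<close>: a letter of the first block counts four times, equal counts never cause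
  a rejection, and by the irrationality of \<open>\<surd>2\<close> different counts cause one with probability at least a
  constant over \<open>n\<^sup>2\<close>.  The rounds of comparisons are repeated until a rejection occurs or two random
  walks together with a biased coin stop the loop, which has probability \<open>\<delta>/n\<^sup>2\<close> per round for a small
  constant \<open>\<delta>\<close>; so wrong words are rejected with probability at least 3/4 before the loop stops, and the expected time
  is polynomial.  Probabilities and expected times are bounded by exhibiting supermartingales.
\<close>

section \<open>Total functions recursive in an oracle\<close>

definition total_rec :: "nat set \<Rightarrow> nat \<Rightarrow> (nat list \<Rightarrow> nat) \<Rightarrow> bool" where
  "total_rec X n f \<longleftrightarrow> (\<exists>p. \<forall>xs. length xs = n \<longrightarrow> computes X p xs (f xs))"

lemma total_rec_nth: "i < n \<Longrightarrow> total_rec X n (\<lambda>xs. xs ! i)"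
  unfolding total_rec_def by (rule exI[of _ "Proj i"]) (auto intro: computes_Proj)

text \<open>The step function of a primitive recursion receives the counter and the accumulator in
  front of the parameters; this rule passes functions of the parameters through.\<close>

lemma total_rec_drop:
  assumes "total_rec X n f"
  shows "total_rec X (Suc (Suc n)) (\<lambda>ys. f (drop 2 ys))"
proof -
  obtain p where p: "length xs = n \<Longrightarrow> computes X p xs (f xs)" for xs
    using assms by (auto simp: total_rec_def)
  have "computes X (Comp p (map (\<lambda>i. Proj (Suc (Suc i))) [0..<n])) ys (f (drop 2 ys))"
    if len: "length ys = Suc (Suc n)" for ys
  proof (rule computes_Comp)
    have "computes X (Proj (Suc (Suc i))) ys (drop 2 ys ! i)" if "i < n" for i
      using computes_Proj[of "Suc (Suc i)" ys X] len that by (simp add: nth_drop)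
    then show "list_all2 (\<lambda>g. computes X g ys) (map (\<lambda>i. Proj (Suc (Suc i))) [0..<n]) (drop 2 ys)"
      using len by (auto simp: list_all2_conv_all_nth)
  qed (use len in \<open>simp add: p\<close>)
  then show ?thesis unfolding total_rec_def by blast
qed

lemma total_rec_comp1:
  assumes p: "\<And>x. computes X p [x] (f x)" and "total_rec X n g"
  shows "total_rec X n (\<lambda>xs. f (g xs))"
proof -
  obtain q where q: "length xs = n \<Longrightarrow> computes X q xs (g xs)" for xs
    using assms(2) by (auto simp: total_rec_def)
  have "computes X (Comp p [q]) xs (f (g xs))" if "length xs = n" for xs
    by (rule computes_Comp[where ys = "[g xs]"]) (auto intro: q that p)
  then show ?thesis unfolding total_rec_def by blast
qed

lemma total_rec_Suc: "total_rec X n g \<Longrightarrow> total_rec X n (\<lambda>xs. Suc (g xs))"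
  by (rule total_rec_comp1) (rule computes_Succ)

lemma total_rec_oracle: "total_rec X n g \<Longrightarrow> total_rec X n (\<lambda>xs. if g xs \<in> X then 1 else 0)"
  by (rule total_rec_comp1) (rule computes_Oracle)

lemma total_rec_const: "total_rec X n (\<lambda>xs. c)"
proof (induction c)
  case 0
  show ?case unfolding total_rec_def by (rule exI[of _ Zero]) (auto intro: computes_Zero)
qed (rule total_rec_Suc)

lemma total_rec_rec_nat:
  assumes b: "total_rec X n b"
    and g: "total_rec X (Suc (Suc n)) (\<lambda>ys. g (ys ! 0) (ys ! 1) (drop 2 ys))"
    and k: "total_rec X n k"
  shows "total_rec X n (\<lambda>xs. rec_nat (b xs) (\<lambda>i y. g i y xs) (k xs))"
proof -
  obtain pb where pb: "length xs = n \<Longrightarrow> computes X pb xs (b xs)" for xs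
    using b by (auto simp: total_rec_def)
  obtain pg where pg: "length ys = Suc (Suc n) \<Longrightarrow>
      computes X pg ys (g (ys ! 0) (ys ! 1) (drop 2 ys))" for ys
    using g by (auto simp: total_rec_def)
  obtain pk where pk: "length xs = n \<Longrightarrow> computes X pk xs (k xs)" for xs
    using k by (auto simp: total_rec_def)
  have rec: "computes X (PrimRec pb pg) (m # xs) (rec_nat (b xs) (\<lambda>i y. g i y xs) m)"
    if "length xs = n" for m xs
  proof (induction m)
    case 0
    then show ?case using that by (auto intro: computes_PrimRec_0 pb)
  next
    case (Suc m)
    show ?case
      using computes_PrimRec_Suc[OF Suc] pg[of "m # rec_nat (b xs) (\<lambda>i y. g i y xs) m # xs"] that
      by (simp add: numeral_2_eq_2)
  qed
  have "computes X (Comp (PrimRec pb pg) (pk # map Proj [0..<n])) xs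
          (rec_nat (b xs) (\<lambda>i y. g i y xs) (k xs))" if len: "length xs = n" for xs
  proof (rule computes_Comp)
    show "list_all2 (\<lambda>g. computes X g xs) (pk # map Proj [0..<n]) (k xs # xs)"
      using len by (auto simp: list_all2_conv_all_nth pk nth_Cons intro: computes_Proj split: nat.split)
  qed (rule rec[OF len])
  then show ?thesis unfolding total_rec_def by blast
qed

section \<open>Closure under arithmetic, each operation being rewritten as a recursion\<close>

lemma total_rec_add:
  assumes "total_rec X n f" "total_rec X n g"
  shows "total_rec X n (\<lambda>xs. f xs + g xs)"
proof -
  have eq: "a + m = rec_nat a (\<lambda>i y. Suc y) m" for a m :: nat
    by (induction m) auto
  show ?thesis
    unfolding eq by (intro total_rec_rec_nat total_rec_Suc total_rec_nth assms) auto
qed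

lemma total_rec_mult:
  assumes "total_rec X n f" "total_rec X n g"
  shows "total_rec X n (\<lambda>xs. f xs * g xs)"
proof -
  have eq: "a * m = rec_nat 0 (\<lambda>i y. y + a) m" for a m :: nat
    by (induction m) auto
  show ?thesis
    unfolding eq
    by (intro total_rec_rec_nat total_rec_add total_rec_nth total_rec_drop total_rec_const assms) auto
qed

lemma total_rec_diff:
  assumes "total_rec X n f" "total_rec X n g"
  shows "total_rec X n (\<lambda>xs. f xs - g xs)"
proof -
  have pred: "m - 1 = rec_nat 0 (\<lambda>i y. i) m" for m :: nat
    by (cases m) auto
  have eq: "a - m = rec_nat a (\<lambda>i y. rec_nat 0 (\<lambda>i y. i) y) m" for a m :: nat
    unfolding pred[symmetric] by (induction m) auto
  show ?thesis
    unfolding eq by (intro total_rec_rec_nat total_rec_nth total_rec_const assms) auto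
qed

lemma total_rec_power:
  assumes "total_rec X n f"
  shows "total_rec X n (\<lambda>xs. c ^ f xs)"
proof -
  have eq: "c ^ m = rec_nat 1 (\<lambda>i y. y * c) m" for m :: nat
    by (induction m) auto
  show ?thesis
    unfolding eq by (intro total_rec_rec_nat total_rec_mult total_rec_nth total_rec_const assms) auto
qed

lemma total_rec_sum:
  assumes "total_rec X (Suc (Suc n)) (\<lambda>ys. g (ys ! 0) (drop 2 ys))" "total_rec X n f"
  shows "total_rec X n (\<lambda>xs. \<Sum>i<f xs. g i xs)"
proof -
  have eq: "(\<Sum>i<m. g i xs) = rec_nat 0 (\<lambda>i y. y + g i xs) m" for m xs
    by (induction m) auto
  show ?thesis
    unfolding eq
    by (intro total_rec_rec_nat total_rec_add total_rec_nth total_rec_const assms) auto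
qed

lemma total_rec_prod_encode:
  assumes "total_rec X n f" "total_rec X n g"
  shows "total_rec X n (\<lambda>xs. prod_encode (f xs, g xs))"
proof -
  have triangle: "triangle m = (\<Sum>i<m. Suc i)" for m
    by (induction m) (auto simp: triangle_Suc)
  show ?thesis
    unfolding prod_encode_def prod.case triangle
    by (intro total_rec_add total_rec_sum total_rec_Suc total_rec_nth total_rec_const assms) auto
qed

lemma total_rec_eq:
  assumes "total_rec X n f" "total_rec X n g"
  shows "total_rec X n (\<lambda>xs. if f xs = g xs then 1 else 0)"
proof -
  have eq: "(if a = b then 1 else 0) = 1 - ((a - b) + (b - a))" for a b :: nat
    by auto
  show ?thesis
    unfolding eq by (intro total_rec_add total_rec_diff total_rec_const assms)
qed

text \<open>
  As \<open>k \<le> word_code (w k)\<close>, a bounded search inverts the coding; it is written as a sum with at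
  most one nonzero term.
\<close>

lemma turing_equivalent_coding:
  fixes L :: "'a::finite list set" and w :: "nat \<Rightarrow> 'b::finite list"
  assumes rec: "\<And>X. total_rec X 1 (\<lambda>xs. word_code (w (xs ! 0)))"
    and inj: "inj w" and ge: "\<And>k. k \<le> word_code (w k)"
  shows "turing_equivalent (w ` word_code ` L) L"
proof -
  have inj_code: "inj (word_code :: 'b list \<Rightarrow> nat)" "inj (word_code :: 'a list \<Rightarrow> nat)"
    by (auto simp: word_code_def inj_def list_encode_eq inj_map_eq_map[OF inj_to_nat])
  let ?X = "word_code ` L" and ?Y = "word_code ` w ` word_code ` L"
  have "total_rec ?Y 1 (\<lambda>xs. if word_code (w (xs ! 0)) \<in> ?Y then 1 else 0)"
    by (intro total_rec_oracle rec)
  then obtain p where p: "computes ?Y p [x] (if word_code (w x) \<in> ?Y then 1 else 0)" for x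
    unfolding total_rec_def by (metis One_nat_def length_Cons list.size(3) nth_Cons_0)
  have "word_code (w (word_code v)) \<in> ?Y \<longleftrightarrow> v \<in> L" for v
    unfolding inj_image_mem_iff[OF inj_code(1)] inj_image_mem_iff[OF inj] inj_image_mem_iff[OF inj_code(2)] ..
  then have "computes ?Y p [word_code v] (if v \<in> L then 1 else 0)" for v
    using p[of "word_code v"] by (simp only:)
  then have "turing_reducible L (w ` word_code ` L)"
    unfolding turing_reducible_def by blast
  moreover have "turing_reducible (w ` word_code ` L) L"
  proof -
    let ?f = "\<lambda>i. word_code (w i)"
    let ?S = "\<lambda>x. \<Sum>i<Suc x. (if ?f i = x then 1 else 0) * (if i \<in> ?X then 1 else 0 :: nat)"
    have f: "total_rec ?X n (\<lambda>ys. ?f (g ys))" if g: "total_rec ?X n g" for n g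
    proof -
      obtain q where q: "length xs = 1 \<Longrightarrow> computes ?X q xs (?f (xs ! 0))" for xs
        using rec[of ?X] unfolding total_rec_def by auto
      have "computes ?X q [x] (?f x)" for x using q[of "[x]"] by simp
      then show ?thesis using g by (rule total_rec_comp1)
    qed
    have "total_rec ?X 1 (\<lambda>xs. ?S (xs ! 0))"
      by (intro total_rec_sum total_rec_mult total_rec_oracle total_rec_eq total_rec_Suc
          total_rec_drop total_rec_nth f) auto
    then obtain p where "length xs = 1 \<Longrightarrow> computes ?X p xs (?S (xs ! 0))" for xs
      unfolding total_rec_def by blast
    from this[of "[x]" for x] have p: "computes ?X p [x] (?S x)" for x by simp
    have "?S (word_code u) = (if u \<in> w ` ?X then 1 else 0)" for u
    proof -
      have eq: "?f i = word_code u \<longleftrightarrow> w i = u" for i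
        using inj_code(1) by (auto simp: inj_def)
      show ?thesis
      proof (cases "u \<in> range w")
        case True
        then obtain k where k: "u = w k" by auto
        have "?S (word_code u) = (\<Sum>i<Suc (word_code u). if i = k then if k \<in> ?X then 1 else 0 else 0)"
          using inj by (intro sum.cong refl) (auto simp: eq[unfolded k] k inj_eq)
        \<comment> \<open>By \<open>ge\<close> the index \<open>k\<close> lies in the range of the
          sum.\<close>
        also have "\<dots> = (if k \<in> ?X then 1 else 0)"
          using ge[of k] k by (simp add: less_Suc_eq_le del: lessThan_Suc sum.lessThan_Suc)
        finally show ?thesis using inj by (simp add: k inj_image_mem_iff)
      qed (auto simp: eq)
    qed
    then have "computes ?X p [word_code u] (if u \<in> w ` ?X then 1 else 0)" for u
      using p[of "word_code u"] by (simp only:)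
    then show ?thesis
      unfolding turing_reducible_def by blast
  qed
  ultimately show ?thesis by (simp add: turing_equivalent_def)
qed

section \<open>The coding words\<close>

fun blocks :: "nat \<Rightarrow> nat \<Rightarrow> ab list" where
  "blocks 0 m = []"
| "blocks (Suc k) m = Sym_b # replicate (4 * m) Sym_a @ blocks k (4 * m)"

definition coding_word :: "nat \<Rightarrow> ab list" where
  "coding_word k = Sym_a # blocks k 1"

lemma length_blocks: "k \<le> length (blocks k m)"
  by (induction k arbitrary: m) (auto simp: le_SucI trans_le_add2)

lemma length_le_list_encode: "length xs \<le> list_encode xs"
proof (induction xs)
  case (Cons x xs)
  then show ?case using le_prod_encode_2[of "list_encode xs" x] by simp
qed simp

lemma le_word_code_coding_word: "k \<le> word_code (coding_word k)"
proof -
  have "k \<le> length (map to_nat (coding_word k))"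
    using length_blocks[of k 1] by (simp add: coding_word_def)
  also have "\<dots> \<le> word_code (coding_word k)"
    unfolding word_code_def by (rule length_le_list_encode)
  finally show ?thesis .
qed

text \<open>The number of letters b recovers the index.\<close>

lemma inj_coding_word: "inj coding_word"
proof (rule injI)
  have *: "length (filter ((=) Sym_b) (blocks k m)) = k" for k m
    by (induction k arbitrary: m) auto
  fix k l assume "coding_word k = coding_word l"
  then have "blocks k 1 = blocks l 1" by (simp add: coding_word_def)
  then show "k = l" using *[of k 1] *[of l 1] by simp
qed

text \<open>Lists are coded from their right end, so the recursion builds the word backwards:
  \<open>suffix k i\<close> is the code of the last \<open>i\<close> blocks, and step
  \<open>j\<close> puts a block of length \<open>4 ^ (k - j)\<close> with its separator in
  front.\<close>

lemma total_rec_word_code_coding_word: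
  "total_rec X 1 (\<lambda>xs. word_code (coding_word (xs ! 0)))"
proof -
  define A B where "A = to_nat Sym_a" and "B = to_nat Sym_b"
  define suffix where "suffix k i = rec_nat 0
      (\<lambda>j c. Suc (prod_encode (B, rec_nat c (\<lambda>_ e. Suc (prod_encode (A, e))) (4 ^ (k - j))))) i" for k i
  have reps: "word_code (replicate l Sym_a @ v) =
      rec_nat (word_code v) (\<lambda>_ e. Suc (prod_encode (A, e))) l" for l v
    by (induction l) (auto simp: word_code_def A_def)
  have suffix: "i \<le> k \<Longrightarrow> suffix k i = word_code (blocks i (4 ^ (k - i)))" for k i
  proof (induction i)
    case (Suc i)
    then have "4 * 4 ^ (k - Suc i) = (4::nat) ^ (k - i)"
      by (metis Suc_diff_Suc Suc_le_lessD power_Suc)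
    then show ?case using Suc
      by (simp add: suffix_def reps[symmetric]) (simp add: word_code_def B_def)
  qed (simp add: suffix_def word_code_def)
  have eq: "word_code (coding_word k) = Suc (prod_encode (A, suffix k k))" for k
    using suffix[of k k] by (simp add: coding_word_def word_code_def A_def)
  show ?thesis
    unfolding eq suffix_def
    by (intro total_rec_Suc total_rec_prod_encode total_rec_rec_nat total_rec_power total_rec_diff
        total_rec_drop total_rec_nth total_rec_const) auto
qed

lemma turing_equivalent_coding_words: "turing_equivalent (coding_word ` word_code ` L) L"
  by (intro turing_equivalent_coding total_rec_word_code_coding_word inj_coding_word
      le_word_code_coding_word)

section \<open>Automata with one real qubit\<close>

text \<open>
  The register holds the state with amplitudes \<open>cos x\<close> and \<open>sin x\<close>.  \<open>Rotation c \<alpha>\<close> is \<open>c\<close> times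
  the rotation by \<open>\<alpha>\<close>, and \<open>Projection c \<alpha> \<beta>\<close> is \<open>c\<close> times the rank one operator that sends the
  state at angle \<open>\<beta>\<close> to the state at angle \<open>\<alpha>\<close>.
\<close>

datatype qubit_op = Rotation real real | Projection real real real

fun op_entry :: "qubit_op \<Rightarrow> nat \<Rightarrow> nat \<Rightarrow> real" where
  "op_entry (Rotation c \<alpha>) i j =
     c * (if i = 0 then (if j = 0 then cos \<alpha> else - sin \<alpha>) else (if j = 0 then sin \<alpha> else cos \<alpha>))"
| "op_entry (Projection c \<alpha> \<beta>) i j =
     c * (if i = 0 then cos \<alpha> else sin \<alpha>) * (if j = 0 then cos \<beta> else sin \<beta>)"

definition op_mat :: "qubit_op \<Rightarrow> complex mat" where
  "op_mat q = mat 2 2 (\<lambda>(i, j). complex_of_real (op_entry q i j))"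

definition qubit :: "real \<Rightarrow> complex Matrix.vec" where
  "qubit x = Matrix.vec 2 (\<lambda>i. complex_of_real (if i = 0 then cos x else sin x))"

fun op_prob :: "qubit_op \<Rightarrow> real \<Rightarrow> real" where
  "op_prob (Rotation c \<alpha>) x = c\<^sup>2"
| "op_prob (Projection c \<alpha> \<beta>) x = (c * cos (x - \<beta>))\<^sup>2"

text \<open>A negative amplitude flips the sign of the new state, which is a shift of its angle by
  \<open>pi\<close>. All quantities used later to bound runs therefore have period \<open>pi\<close>
  in the angle.\<close>

fun op_angle :: "qubit_op \<Rightarrow> real \<Rightarrow> real" where
  "op_angle (Rotation c \<alpha>) x = x + \<alpha>"
| "op_angle (Projection c \<alpha> \<beta>) x = (if cos (x - \<beta>) \<ge> 0 then \<alpha> else \<alpha> + pi)"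

fun op_scale :: "qubit_op \<Rightarrow> real" where
  "op_scale (Rotation c \<alpha>) = c"
| "op_scale (Projection c \<alpha> \<beta>) = c"

definition op_gram :: "qubit_op \<Rightarrow> nat \<Rightarrow> nat \<Rightarrow> real" where
  "op_gram q i j = op_entry q 0 i * op_entry q 0 j + op_entry q 1 i * op_entry q 1 j"

definition complete_ops :: "qubit_op list \<Rightarrow> bool" where
  "complete_ops qs \<longleftrightarrow>
     (\<Sum>q\<leftarrow>qs. op_gram q 0 0) = 1 \<and> (\<Sum>q\<leftarrow>qs. op_gram q 0 1) = 0 \<and> (\<Sum>q\<leftarrow>qs. op_gram q 1 1) = 1"

lemma op_mat_carrier: "op_mat q \<in> carrier_mat 2 2"
  by (simp add: op_mat_def)

lemma qubit_carrier: "qubit x \<in> carrier_vec 2"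
  by (simp add: qubit_def)

lemma vec_norm2_qubit: "vec_norm2 (qubit x) = 1"
  by (simp add: vec_norm2_def qubit_def numeral_2_eq_2)

lemma vec_norm2_smult: "vec_norm2 (complex_of_real c \<cdot>\<^sub>v v) = c\<^sup>2 * vec_norm2 v"
  by (simp add: vec_norm2_def norm_mult power_mult_distrib sum_distrib_left)

lemma op_mat_qubit:
  "op_scale q > 0 \<Longrightarrow>
     op_mat q *\<^sub>v qubit x = complex_of_real (sqrt (op_prob q x)) \<cdot>\<^sub>v qubit (op_angle q x)"
proof (induction q)
  case (Rotation c \<alpha>)
  then show ?case
    by (intro eq_vecI)
       (auto simp: op_mat_def qubit_def scalar_prod_def numeral_2_eq_2 less_Suc_eq cos_add sin_add
          algebra_simps)
next
  case (Projection c \<alpha> \<beta>)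
  then have "sqrt (op_prob (Projection c \<alpha> \<beta>) x) = c * \<bar>cos (x - \<beta>)\<bar>"
    by (simp add: abs_mult)
  then show ?case
    by (intro eq_vecI)
       (auto simp: op_mat_def qubit_def scalar_prod_def numeral_2_eq_2 less_Suc_eq cos_diff
          algebra_simps of_real_add[symmetric] of_real_mult[symmetric] simp del: of_real_add of_real_mult)
qed

lemma op_prob_nonneg: "op_prob q x \<ge> 0"
  by (cases q) auto

lemma vec_norm2_op_mat_qubit: "op_scale q > 0 \<Longrightarrow> vec_norm2 (op_mat q *\<^sub>v qubit x) = op_prob q x"
  by (simp add: op_mat_qubit vec_norm2_smult vec_norm2_qubit op_prob_nonneg)

lemma post_state_op_mat:
  "op_scale q > 0 \<Longrightarrow> op_prob q x \<noteq> 0 \<Longrightarrow> post_state (op_mat q) (qubit x) = qubit (op_angle q x)"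
  by (simp add: post_state_def op_mat_qubit vec_norm2_smult vec_norm2_qubit op_prob_nonneg
      smult_smult_assoc of_real_mult[symmetric] del: of_real_mult of_real_divide)

lemma adjoint_op_mat:
  "mat_adjoint (op_mat q) * op_mat q = mat 2 2 (\<lambda>(i, j). complex_of_real (op_gram q i j))"
  by (intro eq_matI)
     (auto simp: mat_adjoint_def mat_of_rows_def op_mat_def scalar_prod_def op_gram_def numeral_2_eq_2)

lemma superoperator_op_mats:
  assumes "complete_ops qs"
  shows "superoperator 2 (map op_mat qs)"
proof -
  have sum: "foldr (+) (map (\<lambda>E. mat_adjoint E * E) (map op_mat qs)) (0\<^sub>m 2 2) =
      mat 2 2 (\<lambda>(i, j). complex_of_real (\<Sum>q\<leftarrow>qs. op_gram q i j))" for qs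
    by (induction qs) (auto simp: adjoint_op_mat intro!: eq_matI)
  have "op_gram q 1 0 = op_gram q 0 1" for q
    by (simp add: op_gram_def)
  then have "mat 2 2 (\<lambda>(i, j). complex_of_real (\<Sum>q\<leftarrow>qs. op_gram q i j)) = 1\<^sub>m 2"
    using assms by (intro eq_matI) (auto simp: complete_ops_def numeral_2_eq_2 less_Suc_eq)
  then show ?thesis
    unfolding superoperator_def sum using op_mat_carrier by auto
qed

lemma elements_op_mat: "elements_mat (op_mat q) \<subseteq> \<real>"
  by (auto simp: op_mat_def)

section \<open>Runs as Markov chains on state, head position and angle, with supermartingale
  bounds\<close>

lemma prob_bind_pmf:
  assumes "finite A" "set_pmf p \<subseteq> A"
  shows "measure_pmf.prob (bind_pmf p f) S = (\<Sum>a\<in>A. pmf p a * measure_pmf.prob (f a) S)"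
proof -
  have "ennreal (measure_pmf.prob (bind_pmf p f) S) = (\<integral>\<^sup>+x. ennreal (measure_pmf.prob (f x) S) \<partial>p)"
    by (simp add: measure_pmf.emeasure_eq_measure[symmetric])
  also have "\<dots> = (\<Sum>a\<in>A. ennreal (measure_pmf.prob (f a) S) * pmf p a)"
    using assms by (intro nn_integral_measure_pmf_support) auto
  also have "\<dots> = ennreal (\<Sum>a\<in>A. pmf p a * measure_pmf.prob (f a) S)"
    by (simp add: ennreal_mult'[symmetric] mult.commute)
  finally show ?thesis
    by (subst (asm) ennreal_inj) (auto intro: sum_nonneg)
qed

text \<open>A rule list gives for each outcome the operator, the next state and the head movement.\<close>

type_synonym 'a qubit_rules = "nat \<Rightarrow> 'a tape_symbol \<Rightarrow> (qubit_op \<times> nat \<times> move) list"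

definition qubit_machine :: "nat \<Rightarrow> nat set \<Rightarrow> nat set \<Rightarrow> 'a qubit_rules \<Rightarrow> 'a qcfa" where
  "qubit_machine n A R \<rho> = \<lparr>num_states = n, init_state = 0, acc_states = A, rej_states = R, qdim = 2,
     init_qstate = 0, qop = (\<lambda>s \<sigma>. map (\<lambda>r. op_mat (fst r)) (\<rho> s \<sigma>)),
     trans = (\<lambda>s \<sigma> i. snd (\<rho> s \<sigma> ! i))\<rparr>"

locale qubit_automaton =
  fixes n :: nat and A R :: "nat set" and \<rho> :: "'a qubit_rules"
  assumes states: "0 < n" "A \<subseteq> {..<n}" "R \<subseteq> {..<n}" "A \<inter> R = {}"
    and complete: "s \<notin> A \<union> R \<Longrightarrow> complete_ops (map fst (\<rho> s \<sigma>))"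
    and scale: "(q, r) \<in> set (\<rho> s \<sigma>) \<Longrightarrow> op_scale q > 0"
    and next_state: "s < n \<Longrightarrow> (q, s', m) \<in> set (\<rho> s \<sigma>) \<Longrightarrow> s' < n"
    and left_end: "(q, s', MoveLeft) \<notin> set (\<rho> s LeftEnd)"
    and right_end: "(q, s', MoveRight) \<notin> set (\<rho> s RightEnd)"
begin

abbreviation M :: "'a qcfa" where "M \<equiv> qubit_machine n A R \<rho>"

lemma halting_M: "halting M = A \<union> R"
  by (simp add: halting_def qubit_machine_def)

lemma is_2qcfa_M: "is_2qcfa M"
proof -
  have op: "superoperator 2 (map (\<lambda>r. op_mat (fst r)) (\<rho> s \<sigma>))" if "s \<notin> A \<union> R" for s \<sigma>
    using superoperator_op_mats[OF complete[OF that]] by (simp add: comp_def)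
  have nx: "fst (snd (\<rho> s \<sigma> ! i)) < n" if "s < n" "i < length (\<rho> s \<sigma>)" for s \<sigma> i
    using next_state[OF that(1), of "fst (\<rho> s \<sigma> ! i)" _ "snd (snd (\<rho> s \<sigma> ! i))"] nth_mem[OF that(2)] by simp
  have le: "snd (snd (\<rho> s LeftEnd ! i)) \<noteq> MoveLeft" if "i < length (\<rho> s LeftEnd)" for s i
    using left_end nth_mem[OF that] by (metis prod.collapse)
  have re: "snd (snd (\<rho> s RightEnd ! i)) \<noteq> MoveRight" if "i < length (\<rho> s RightEnd)" for s i
    using right_end nth_mem[OF that] by (metis prod.collapse)
  show ?thesis
    using states elements_op_mat op nx le re
    unfolding is_2qcfa_def halting_M by (auto simp: qubit_machine_def)
qed

lemma init_config_M: "init_config M = (0, 0, qubit 0)"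
  by (auto simp: init_config_def qubit_machine_def qubit_def unit_vec_def intro!: eq_vecI)

lemma prob_run_Suc:
  assumes s: "s \<notin> A \<union> R"
  shows "measure_pmf.prob (run M w (Suc t) (s, h, qubit x)) S =
    (\<Sum>(q, s', m)\<leftarrow>\<rho> s (tape w h).
       op_prob q x * measure_pmf.prob (run M w t (s', move_head m h, qubit (op_angle q x))) S)"
proof -
  define rs where "rs = \<rho> s (tape w h)"
  let ?Es = "map (\<lambda>r. op_mat (fst r)) rs"
  let ?P = "\<lambda>s' m E. measure_pmf.prob (run M w t (s', move_head m h, E)) S"
  have op: "superoperator 2 ?Es"
    using superoperator_op_mats[OF complete[OF s]] by (simp add: comp_def rs_def)
  have scale_nth: "op_scale (fst (rs ! i)) > 0" if "i < length rs" for i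
    using scale[of "fst (rs ! i)" "snd (rs ! i)" s "tape w h"] nth_mem[OF that] by (simp add: rs_def)
  have pmf: "pmf (outcome_pmf ?Es (qubit x)) i =
      (if i < length rs then op_prob (fst (rs ! i)) x else 0)" for i
    by (simp add: pmf_outcome_pmf[OF op qubit_carrier vec_norm2_qubit] vec_norm2_op_mat_qubit scale_nth)
  have set: "set_pmf (outcome_pmf ?Es (qubit x)) \<subseteq> {..<length rs}"
    by (auto simp: set_pmf_iff pmf split: if_splits)
  have "run M w (Suc t) (s, h, qubit x) = bind_pmf (outcome_pmf ?Es (qubit x))
      (\<lambda>i. run M w t (case snd (rs ! i) of (s', m) \<Rightarrow>
          (s', move_head m h, post_state (?Es ! i) (qubit x))))"
    using s by (simp add: step_def halting_M bind_map_pmf)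
      (simp add: qubit_machine_def rs_def Let_def bind_map_pmf)
  then have "measure_pmf.prob (run M w (Suc t) (s, h, qubit x)) S =
      (\<Sum>i<length rs. op_prob (fst (rs ! i)) x *
        ?P (fst (snd (rs ! i))) (snd (snd (rs ! i))) (post_state (?Es ! i) (qubit x)))"
    by (simp add: prob_bind_pmf[OF _ set] pmf case_prod_unfold)
  also have "\<dots> = (\<Sum>i<length rs. op_prob (fst (rs ! i)) x *
        ?P (fst (snd (rs ! i))) (snd (snd (rs ! i))) (qubit (op_angle (fst (rs ! i)) x)))"
  proof (intro sum.cong refl)
    fix i assume "i \<in> {..<length rs}"
    then have "op_scale (fst (rs ! i)) > 0" and "?Es ! i = op_mat (fst (rs ! i))"
      by (simp_all add: scale_nth)
    then show "op_prob (fst (rs ! i)) x *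
        ?P (fst (snd (rs ! i))) (snd (snd (rs ! i))) (post_state (?Es ! i) (qubit x)) =
      op_prob (fst (rs ! i)) x *
        ?P (fst (snd (rs ! i))) (snd (snd (rs ! i))) (qubit (op_angle (fst (rs ! i)) x))"
      \<comment> \<open>For an outcome of probability 0, \<open>post_state\<close> divides by zero
        and need not be the expected qubit, but the factor in front vanishes.\<close>
      by (cases "op_prob (fst (rs ! i)) x = 0") (simp_all add: post_state_op_mat)
  qed
  finally show ?thesis
    by (simp add: sum_list_sum_nth rs_def[symmetric] atLeast0LessThan case_prod_unfold)
qed

lemma run_halted: "s \<in> A \<union> R \<Longrightarrow> run M w t (s, h, \<psi>) = return_pmf (s, h, \<psi>)"
  by (induction t) (auto simp: step_def halting_M bind_return_pmf)

text \<open>Supermartingale bound by induction on time: \<open>V\<close> dominates the indicator of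
  the target, and one step does not raise its expected value.\<close>

lemma run_prob_le:
  fixes V :: "nat \<Rightarrow> nat \<Rightarrow> real \<Rightarrow> real"
  assumes inv: "\<And>s h q s' m. I s h \<Longrightarrow> s \<notin> A \<union> R \<Longrightarrow> (q, s', m) \<in> set (\<rho> s (tape w h)) \<Longrightarrow>
      I s' (move_head m h)"
    and nonneg: "\<And>s h x. I s h \<Longrightarrow> V s h x \<ge> 0"
    and super: "\<And>s h x. I s h \<Longrightarrow> s \<notin> A \<union> R \<Longrightarrow>
      (\<Sum>(q, s', m)\<leftarrow>\<rho> s (tape w h). op_prob q x * V s' (move_head m h) (op_angle q x)) \<le> V s h x"
    and target: "T \<subseteq> A \<union> R" "\<And>s h x. I s h \<Longrightarrow> s \<in> T \<Longrightarrow> V s h x \<ge> 1"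
    and "I s h"
  shows "measure_pmf.prob (run M w t (s, h, qubit x)) {c. fst c \<in> T} \<le> V s h x"
  using \<open>I s h\<close>
proof (induction t arbitrary: s h x)
  case 0
  then show ?case using nonneg[of s h x] target(2)[of s h x] by (auto simp: indicator_def)
next
  case (Suc t)
  show ?case
  proof (cases "s \<in> A \<union> R")
    case True
    then show ?thesis
      using Suc.prems nonneg[of s h x] target(2)[of s h x]
      unfolding run_halted[OF True] by (auto simp: indicator_def)
  next
    case False
    have "measure_pmf.prob (run M w (Suc t) (s, h, qubit x)) {c. fst c \<in> T} \<le>
        (\<Sum>(q, s', m)\<leftarrow>\<rho> s (tape w h). op_prob q x * V s' (move_head m h) (op_angle q x))"
      unfolding prob_run_Suc[OF False]
      using inv[OF Suc.prems False] Suc.IH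
      by (intro sum_list_mono) (auto intro!: mult_left_mono op_prob_nonneg)
    also have "\<dots> \<le> V s h x" by (rule super[OF Suc.prems False])
    finally show ?thesis .
  qed
qed

text \<open>Here \<open>V\<close> drops by at least 1 per step in expectation, so it pays for every
  step made before halting.\<close>

lemma run_time_le:
  fixes V :: "nat \<Rightarrow> nat \<Rightarrow> real"
  assumes inv: "\<And>s h q s' m. I s h \<Longrightarrow> s \<notin> A \<union> R \<Longrightarrow> (q, s', m) \<in> set (\<rho> s (tape w h)) \<Longrightarrow>
      I s' (move_head m h)"
    and nonneg: "\<And>s h. I s h \<Longrightarrow> V s h \<ge> 0"
    and super: "\<And>s h x. I s h \<Longrightarrow> s \<notin> A \<union> R \<Longrightarrow>
      1 + (\<Sum>(q, s', m)\<leftarrow>\<rho> s (tape w h). op_prob q x * V s' (move_head m h)) \<le> V s h"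
    and "I s h"
  shows "(\<Sum>t<k. measure_pmf.prob (run M w t (s, h, qubit x)) {c. fst c \<in> - halting M}) \<le> V s h"
  using \<open>I s h\<close>
proof (induction k arbitrary: s h x)
  case 0
  then show ?case using nonneg by simp
next
  case (Suc k)
  show ?case
  proof (cases "s \<in> A \<union> R")
    case True
    then show ?thesis
      using nonneg[OF Suc.prems]
      unfolding run_halted[OF True] halting_M by (auto simp: indicator_def)
  next
    case False
    let ?P = "\<lambda>t s h x. measure_pmf.prob (run M w t (s, h, qubit x)) {c. fst c \<in> - halting M}"
    have "(\<Sum>t<Suc k. ?P t s h x) \<le> 1 + (\<Sum>t<k. ?P (Suc t) s h x)"
      unfolding sum.lessThan_Suc_shift by simp
    also have "(\<Sum>t<k. ?P (Suc t) s h x) =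
        (\<Sum>(q, s', m)\<leftarrow>\<rho> s (tape w h). op_prob q x *
          (\<Sum>t<k. ?P t s' (move_head m h) (op_angle q x)))"
      unfolding prob_run_Suc[OF False]
      by (simp add: sum_list_sum_nth case_prod_unfold sum_distrib_left) (rule sum.swap)
    also have "\<dots> \<le> (\<Sum>(q, s', m)\<leftarrow>\<rho> s (tape w h). op_prob q x * V s' (move_head m h))"
      using inv[OF Suc.prems False] Suc.IH
      by (intro sum_list_mono) (auto intro!: mult_left_mono op_prob_nonneg)
    also have "1 + \<dots> \<le> V s h" by (rule super[OF Suc.prems False])
    finally show ?thesis by simp
  qed
qed

end


text \<open>A bound on all partial sums makes the series of running probabilities converge. Its sum
  is the expected time, and its terms tend to 0, so the machine halts almost surely.\<close>

lemma
  fixes B :: real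
  assumes time: "\<And>k. (\<Sum>t<k. state_prob M w t (- halting M)) \<le> B"
  shows expected_steps_le: "expected_steps M w \<le> ennreal B"
    and state_prob_running_tendsto: "(\<lambda>t. state_prob M w t (- halting M)) \<longlonglongrightarrow> 0"
proof -
  have nonneg: "state_prob M w t S \<ge> 0" for t S
    by (simp add: state_prob_def)
  have "summable (\<lambda>t. state_prob M w t (- halting M))"
    by (rule summableI_nonneg_bounded[OF nonneg time])
  then show "(\<lambda>t. state_prob M w t (- halting M)) \<longlonglongrightarrow> 0"
    by (rule summable_LIMSEQ_zero)
  show "expected_steps M w \<le> ennreal B"
    unfolding expected_steps_def suminf_eq_SUP
    by (intro SUP_least) (simp add: nonneg sum_nonneg time ennreal_leI)
qed

text \<open>Supermartingales give upper bounds only. Since the probability of still running vanishes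
  in the limit, an upper bound for the wrong verdict becomes a lower bound for the right
  one.\<close>

lemma halting_prob_complement:
  assumes le: "\<And>t. state_prob M w t S \<le> p" and lim: "(\<lambda>t. state_prob M w t (- halting M)) \<longlonglongrightarrow> 0"
    and split: "S \<union> S' = halting M"
  shows "1 - p \<le> (SUP t. state_prob M w t S')"
proof -
  have bdd: "bdd_above (range (\<lambda>t. state_prob M w t S'))"
    by (rule bdd_aboveI[of _ 1]) (auto simp: state_prob_def)
  have "1 \<le> state_prob M w t S + state_prob M w t S' + state_prob M w t (- halting M)" for t
  proof -
    let ?r = "run M w t (init_config M)"
    have "1 = measure_pmf.prob ?r ({c. fst c \<in> S} \<union> {c. fst c \<in> S'} \<union> {c. fst c \<in> - halting M})"
      using split measure_pmf.prob_space[of ?r] by (subst arg_cong[where y = UNIV]) auto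
    also have "\<dots> \<le> measure_pmf.prob ?r {c. fst c \<in> S} + measure_pmf.prob ?r {c. fst c \<in> S'} +
        measure_pmf.prob ?r {c. fst c \<in> - halting M}"
      by (intro order_trans[OF measure_Un_le] add_right_mono measure_Un_le) auto
    finally show ?thesis by (simp add: state_prob_def)
  qed
  moreover have "state_prob M w t S' \<le> (SUP t. state_prob M w t S')" for t
    by (rule cSUP_upper[OF _ bdd]) simp
  ultimately have "1 - p - state_prob M w t (- halting M) \<le> (SUP t. state_prob M w t S')" for t
    using le[of t] by (smt (verit))
  then show ?thesis
    using LIMSEQ_le_const2[OF tendsto_diff[OF tendsto_const lim]] by (metis diff_zero)
qed

section \<open>Two angles\<close>

text \<open>The exponent of 2 is odd on the left and even on the right.\<close>

lemma two_square_neq_square: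
  fixes d m :: int
  assumes "d \<noteq> 0"
  shows "2 * d\<^sup>2 \<noteq> m\<^sup>2"
proof
  assume eq: "2 * d\<^sup>2 = m\<^sup>2"
  with assms have "m \<noteq> 0" by auto
  have prime: "prime_elem (2 :: int)" by simp
  have "multiplicity 2 (2 * d\<^sup>2) = 1 + 2 * multiplicity 2 d"
    using assms by (simp add: prime_elem_multiplicity_mult_distrib[OF prime]
        prime_elem_multiplicity_power_distrib[OF prime])
  moreover have "multiplicity 2 (m\<^sup>2) = 2 * multiplicity 2 m"
    using \<open>m \<noteq> 0\<close> by (simp add: prime_elem_multiplicity_power_distrib[OF prime])
  ultimately have "1 + 2 * multiplicity 2 d = 2 * multiplicity 2 m"
    using eq by simp
  then show False by presburger
qed

lemma sin_pi_square_ge: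
  fixes y :: real
  assumes "\<bar>y\<bar> \<le> 1 / 2"
  shows "y\<^sup>2 \<le> (sin (pi * y))\<^sup>2"
proof -
  have *: "y \<le> sin (pi * y)" if "0 \<le> y" "y \<le> 1 / 2" for y :: real
  \<comment> \<open>Up to 1/6 the cubic Taylor bound is used; beyond, monotonicity gives at least
    \<open>sin (pi / 6)\<close>, which is 1/2.\<close>
  proof (cases "y \<le> 1 / 6")
    case True
    define t where "t = pi * y"
    have pi: "3 \<le> pi" "pi < 4" using pi_gt3 pi_less_4 by auto
    have t: "0 \<le> t" "3 * y \<le> t" "t \<le> 1"
      using that(1) mult_right_mono[OF pi(1) that(1)] mult_mono[of pi 4 y "1 / 6"] pi(2) True
      unfolding t_def by linarith+
    have "\<bar>sin t - t\<bar> \<le> \<bar>t\<bar> ^ 3 / 6"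
      using Maclaurin_sin_bound[of t 3] by (simp add: sin_coeff_def numeral_3_eq_3 lessThan_Suc fact_numeral)
    moreover have "\<bar>t\<bar> ^ 3 \<le> t"
      using t power_decreasing[of 1 3 t] by simp
    ultimately have "sin t \<ge> t - t / 6" by (simp add: abs_if split: if_splits)
    then show ?thesis using t \<open>0 \<le> y\<close> unfolding t_def[symmetric] by linarith
  next
    case False
    have "sin (pi / 6) \<le> sin (pi * y)"
      using that False by (intro sin_monotone_2pi_le) (auto simp: field_simps)
    then show ?thesis using that by (simp add: sin_30)
  qed
  have "\<bar>y\<bar> \<le> sin (pi * \<bar>y\<bar>)" using assms by (intro *) auto
  then have "\<bar>y\<bar>\<^sup>2 \<le> (sin (pi * \<bar>y\<bar>))\<^sup>2" by (intro power_mono) auto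
  then show ?thesis by (simp add: abs_if split: if_splits)
qed

definition sqrt2_angle :: real where "sqrt2_angle = sqrt 2 * pi"

text \<open>Since \<open>\<bar>2 d\<^sup>2 - m\<^sup>2\<bar> \<ge> 1\<close> for integers \<open>d \<noteq> 0\<close>, the number \<open>d \<surd>2\<close> is far from every integer \<open>m\<close>.\<close>

lemma sin_sqrt2_angle_ge:
  fixes d :: int and D :: real
  assumes "d \<noteq> 0" "\<bar>d\<bar> \<le> D"
  shows "1 / (16 * D\<^sup>2) \<le> (sin (d * sqrt2_angle))\<^sup>2"
proof -
  define x where "x = sqrt 2 * d"
  define m where "m = round x"
  define y where "y = x - m"
  have y: "\<bar>y\<bar> \<le> 1 / 2"
    using of_int_round_abs_le[of x] by (simp add: y_def m_def abs_minus_commute)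
  have d1: "1 \<le> \<bar>d\<bar>" using assms by linarith
  have x: "\<bar>x\<bar> \<le> (3 / 2) * \<bar>d\<bar>"
  proof -
    have "sqrt 2 \<le> 3 / 2" by (rule real_le_lsqrt) (auto simp: power2_eq_square)
    then show ?thesis
      using mult_right_mono[of "sqrt 2" "3 / 2" "\<bar>real_of_int d\<bar>"] by (simp add: x_def abs_mult)
  qed
  \<comment> \<open>Twice 3/2 of the absolute value of \<open>d\<close>, plus 1/2, is at most 4
    times that value; squaring this 4 yields the 16 of the claim.\<close>
  have sum: "\<bar>x\<bar> + \<bar>m\<bar> \<le> 4 * \<bar>d\<bar>"
  proof -
    have "\<bar>real_of_int m\<bar> \<le> \<bar>x\<bar> + 1 / 2"
      using y unfolding y_def by linarith
    moreover have "1 \<le> \<bar>real_of_int d\<bar>" using d1 by linarith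
    ultimately show ?thesis using x unfolding of_int_abs by linarith
  qed
  have sq: "x\<^sup>2 - m\<^sup>2 = of_int (2 * d\<^sup>2 - m\<^sup>2)"
    by (simp add: x_def power_mult_distrib)
  have "1 \<le> \<bar>2 * d\<^sup>2 - m\<^sup>2\<bar>"
    using two_square_neq_square[OF assms(1), of m] by linarith
  then have "1 \<le> \<bar>x\<^sup>2 - m\<^sup>2\<bar>"
    unfolding sq by (metis of_int_1_le_iff of_int_abs)
  also have "\<dots> = \<bar>y\<bar> * \<bar>x + m\<bar>"
    by (simp add: y_def abs_mult[symmetric] power2_eq_square algebra_simps)
  also have "\<dots> \<le> \<bar>y\<bar> * (4 * \<bar>d\<bar>)"
    using sum by (intro mult_left_mono) auto
  also have "\<dots> \<le> \<bar>y\<bar> * (4 * D)"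
    using assms(2) by (intro mult_left_mono) auto
  finally have "1 \<le> \<bar>y\<bar> * (4 * D)" .
  then have "1\<^sup>2 \<le> (\<bar>y\<bar> * (4 * D))\<^sup>2" by (intro power_mono) auto
  moreover have "D > 0" using d1 assms by linarith
  ultimately have "1 / (16 * D\<^sup>2) \<le> y\<^sup>2"
    by (simp add: power_mult_distrib field_simps)
  also have "\<dots> \<le> (sin (pi * y))\<^sup>2" by (rule sin_pi_square_ge[OF y])
  also have "sin (pi * y) = sin (d * sqrt2_angle - pi * m)"
    by (simp add: y_def x_def sqrt2_angle_def algebra_simps)
  also have "(\<dots>)\<^sup>2 = (sin (d * sqrt2_angle))\<^sup>2"
  proof -
    have "(cos (pi * m))\<^sup>2 = 1"
      using sin_cos_squared_add[of "pi * m"] by simp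
    then show ?thesis by (simp add: sin_diff power_mult_distrib)
  qed
  finally show ?thesis .
qed

text \<open>The digits in base 4 of \<open>set_angle X\<close>, in units of a right angle, list the elements of \<open>X\<close>.\<close>

definition set_angle :: "nat set \<Rightarrow> real" where
  "set_angle X = (\<Sum>j. indicator X j * (pi / 2) * (1 / 4) ^ j)"

text \<open>A digit \<open>j < k\<close> now contributes 0 or \<open>4 ^ (k - j)\<close> right
  angles, a number divisible by 4, hence whole turns. The digits after \<open>k\<close> add at most
  \<open>(pi / 2) * (1 / 4 + 1 / 16 + ...) = pi / 6\<close>.\<close>

lemma set_angle_shift:
  "\<exists>M t. 4 ^ k * set_angle X = 2 * pi * real M + indicator X k * (pi / 2) + t \<and> 0 \<le> t \<and> t \<le> pi / 6"
proof -
  define f where "f Y j = indicator Y j * (pi / 2) * (1 / 4 :: real) ^ j" for Y :: "nat set" and j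
  have geo: "(\<lambda>j. pi / 2 * (1 / 4 :: real) ^ j) sums (pi / 2 * (4 / 3))"
    using sums_mult[OF geometric_sums[of "1 / 4 :: real"], of "pi / 2"] by simp
  have f: "0 \<le> f Y j" "f Y j \<le> pi / 2 * (1 / 4) ^ j" for Y j
    by (auto simp: f_def indicator_def)
  have summable: "summable (f Y)" for Y
    by (rule summable_comparison_test[OF _ sums_summable[OF geo]]) (use f in \<open>auto intro!: exI[of _ 0]\<close>)
  have bounds: "0 \<le> suminf (f Y)" "suminf (f Y) \<le> pi / 2 * (4 / 3)" for Y
    using suminf_nonneg[OF summable] f suminf_le[OF f(2) summable sums_summable[OF geo], of Y]
      sums_unique[OF geo] by auto
  define Y where "Y = {j. j + Suc k \<in> X}"
  have shift: "f X (j + Suc k) = (1 / 4) ^ Suc k * f Y j" for j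
    by (simp add: f_def Y_def indicator_def power_add)
  have "set_angle X = (\<Sum>j. f X (j + Suc k)) + (\<Sum>j<Suc k. f X j)"
    unfolding set_angle_def f_def[symmetric] by (rule suminf_split_initial_segment[OF summable])
  also have "(\<Sum>j. f X (j + Suc k)) = (1 / 4) ^ Suc k * suminf (f Y)"
    unfolding shift by (rule suminf_mult[OF summable])
  finally have "4 ^ k * set_angle X = (\<Sum>j<k. 4 ^ k * f X j) + indicator X k * (pi / 2) + suminf (f Y) / 4"
    by (simp add: f_def distrib_left sum_distrib_left power_divide)
  also have "(\<Sum>j<k. 4 ^ k * f X j) = 2 * pi * real (\<Sum>j<k. indicator X j * 4 ^ (k - Suc j))"
    unfolding of_nat_sum sum_distrib_left
  proof (intro sum.cong refl)
    fix j assume "j \<in> {..<k}"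
    then have "k = Suc (k - Suc j + j)" by simp
    then have "(4 :: real) ^ k = 4 * 4 ^ (k - Suc j) * 4 ^ j"
      by (metis power_Suc power_add mult.assoc)
    then show "4 ^ k * f X j = 2 * pi * real (indicator X j * 4 ^ (k - Suc j))"
      by (simp add: f_def indicator_def power_divide)
  qed
  finally show ?thesis using bounds[of Y] by (intro exI conjI) (assumption, auto)
qed

text \<open>Up to whole turns the angle exceeds \<open>pi / 2\<close> or 0 by at most
  \<open>pi / 6\<close>, whose sine is 1/2.\<close>

lemma sin_set_angle:
  "k \<in> X \<Longrightarrow> 3 / 4 \<le> (sin (4 ^ k * set_angle X))\<^sup>2"
  "k \<notin> X \<Longrightarrow> (sin (4 ^ k * set_angle X))\<^sup>2 \<le> 1 / 4"
proof -
  obtain M t where M: "4 ^ k * set_angle X = 2 * pi * real M + indicator X k * (pi / 2) + t"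
    and t: "0 \<le> t" "t \<le> pi / 6"
    using set_angle_shift by blast
  have shift: "sin (2 * pi * real M + x) = sin x" for x
  proof -
    have "2 * pi * real M = 2 * real M * pi" by simp
    then show ?thesis by (simp only: sin_add sin_2npi cos_2npi mult_zero_left mult_1_left add_0_left)
  qed
  have "sin t \<le> sin (pi / 6)"
    using t by (intro sin_monotone_2pi_le) auto
  moreover have "0 \<le> sin t" using t by (intro sin_ge_zero) auto
  ultimately have "(sin t)\<^sup>2 \<le> (1 / 2)\<^sup>2" by (intro power_mono) (auto simp: sin_30)
  then have s: "(sin t)\<^sup>2 \<le> 1 / 4" by (simp add: power2_eq_square)
  show "3 / 4 \<le> (sin (4 ^ k * set_angle X))\<^sup>2" if "k \<in> X"
  proof -
    have "sin (4 ^ k * set_angle X) = cos t"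
      using that shift[of "pi / 2 + t"] by (simp add: M add.assoc sin_add)
    then show ?thesis using s by (simp add: cos_squared_eq)
  qed
  show "(sin (4 ^ k * set_angle X))\<^sup>2 \<le> 1 / 4" if "k \<notin> X"
    using that s shift[of t] by (simp add: M)
qed

section \<open>Comparing neighbouring blocks\<close>

text \<open>
  \<open>consistent False\<close> is inside a first block of a pair, where each letter \<open>a\<close> adds 4 to the
  counter, and \<open>consistent True\<close> inside a second block, which counts down to 0.  In \<open>survival\<close> the
  counter is replaced by a multiple of \<open>sqrt2_angle\<close> and each test is passed with the probability
  of a quantum measurement.
\<close>

fun consistent :: "bool \<Rightarrow> ab list \<Rightarrow> int \<Rightarrow> bool" where
  "consistent c [] d \<longleftrightarrow> (c \<longrightarrow> d = 0)"
| "consistent c (Sym_a # v) d \<longleftrightarrow> consistent c v (if c then d - 1 else d + 4)"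
| "consistent c (Sym_b # v) d \<longleftrightarrow> (if c then d = 0 \<and> consistent False v 0 else consistent True v d)"

fun survival :: "bool \<Rightarrow> ab list \<Rightarrow> real \<Rightarrow> real" where
  "survival c [] x = (if c then (cos x)\<^sup>2 else 1)"
| "survival c (Sym_a # v) x = survival c v (if c then x - sqrt2_angle else x + 4 * sqrt2_angle)"
| "survival c (Sym_b # v) x = (if c then (cos x)\<^sup>2 * survival False v 0 else survival True v x)"

lemma survival_bounds: "0 \<le> survival c v x" "survival c v x \<le> 1"
proof -
  have "0 \<le> survival c v x \<and> survival c v x \<le> 1"
    by (induction c v x rule: survival.induct)
       (auto simp: abs_square_le_1 intro!: mult_le_one)
  then show "0 \<le> survival c v x" "survival c v x \<le> 1" by auto
qed

lemma survival_add_pi: "survival c v (x + pi) = survival c v x"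
proof (induction c v x rule: survival.induct)
  case (2 c v x)
  then show ?case by (auto simp: algebra_simps)
qed auto

lemma survival_consistent: "consistent c v d \<Longrightarrow> survival c v (d * sqrt2_angle) = 1"
proof (induction c v d rule: consistent.induct)
  case (2 c v d)
  then show ?case by (cases c) (auto simp: algebra_simps)
next
  case (3 c v d)
  then show ?case by (cases c) auto
qed auto

text \<open>A letter changes the counter by at most 4, so \<open>D\<close> bounds it on the whole
  remaining word. The first failing test then measures a nonzero multiple of
  \<open>sqrt2_angle\<close>, and the later factors are at most 1.\<close>

lemma survival_inconsistent:
  "\<not> consistent c v d \<Longrightarrow> \<bar>d\<bar> + 4 * int (length v) \<le> D \<Longrightarrow>
     survival c v (d * sqrt2_angle) \<le> 1 - 1 / (16 * (real_of_int D)\<^sup>2)"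
proof (induction c v d rule: consistent.induct)
  case (1 c d)
  then have "d \<noteq> 0" "\<bar>d\<bar> \<le> D" by auto
  then show ?case
    using sin_sqrt2_angle_ge[of d D] 1 by (simp add: cos_squared_eq)
next
  case (2 c v d)
  then show ?case by (cases c) (auto simp: algebra_simps)
next
  case (3 c v d)
  show ?case
  proof (cases "c \<and> d \<noteq> 0")
    case True
    have "survival c (Sym_b # v) (d * sqrt2_angle) \<le> (cos (d * sqrt2_angle))\<^sup>2 * 1"
      using True survival_bounds[of False v 0] by (auto intro!: mult_left_le)
    also have "\<dots> \<le> 1 - 1 / (16 * (real_of_int D)\<^sup>2)"
      using sin_sqrt2_angle_ge[of d D] True 3 by (simp add: cos_squared_eq)
    finally show ?thesis .
  next
    case False
    then show ?thesis using 3 by (cases c) auto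
  qed
qed

text \<open>Both phases are followed in parallel: one has read \<open>j\<close> letters of its first
  block, the other still expects \<open>r\<close> letters of its second. A letter a moves one unit
  from \<open>r\<close> to \<open>j\<close>; a letter b forces \<open>r = 0\<close> and swaps the
  roles, giving the pair \<open>0\<close> and \<open>4 * j\<close>. Together they compare every
  block with its successor.\<close>

lemma consistent_iff_blocks:
  "consistent False v (4 * int j) \<and> consistent True v r \<longleftrightarrow>
     (\<exists>k. 0 \<le> r \<and> v = replicate (nat r) Sym_a @ blocks k (j + nat r))"
proof (induction v arbitrary: j r)
  case Nil
  have "blocks k m = [] \<longleftrightarrow> k = 0" for k m by (cases k) auto
  then show ?case by auto
next
  case (Cons c v)
  show ?case
  proof (cases c)
    case Sym_a
    have "consistent False (c # v) (4 * int j) \<and> consistent True (c # v) r \<longleftrightarrow>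
        (\<exists>k. 1 \<le> r \<and> v = replicate (nat (r - 1)) Sym_a @ blocks k (Suc j + nat (r - 1)))"
      using Cons[of "Suc j" "r - 1"] by (simp add: Sym_a algebra_simps)
    also have "\<dots> \<longleftrightarrow> (\<exists>k. 0 \<le> r \<and> c # v = replicate (nat r) Sym_a @ blocks k (j + nat r))"
    proof (cases "1 \<le> r")
      case True
      then have "nat r = Suc (nat (r - 1))" by simp
      then show ?thesis using True by (simp add: Sym_a)
    next
      case False
      have "Sym_a # v \<noteq> blocks k j" for k by (cases k) auto
      then show ?thesis using False by (auto simp: Sym_a)
    qed
    finally show ?thesis .
  next
    case Sym_b
    have "consistent False (c # v) (4 * int j) \<and> consistent True (c # v) r \<longleftrightarrow>
        r = 0 \<and> (\<exists>k. v = replicate (4 * j) Sym_a @ blocks k (4 * j))"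
      using Cons[of 0 "int (4 * j)"] by (auto simp: Sym_b nat_mult_distrib)
    also have "\<dots> \<longleftrightarrow> (\<exists>k. 0 \<le> r \<and> c # v = replicate (nat r) Sym_a @ blocks k (j + nat r))"
    proof
      assume *: "r = 0 \<and> (\<exists>k. v = replicate (4 * j) Sym_a @ blocks k (4 * j))"
      then obtain k where "v = replicate (4 * j) Sym_a @ blocks k (4 * j)" by auto
      then have "c # v = blocks (Suc k) j" by (simp add: Sym_b)
      then show "\<exists>k. 0 \<le> r \<and> c # v = replicate (nat r) Sym_a @ blocks k (j + nat r)"
        using * by (intro exI[of _ "Suc k"]) simp
    next
      assume "\<exists>k. 0 \<le> r \<and> c # v = replicate (nat r) Sym_a @ blocks k (j + nat r)"
      then obtain k where k: "0 \<le> r" "Sym_b # v = replicate (nat r) Sym_a @ blocks k (j + nat r)"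
        by (auto simp: Sym_b)
      then have "nat r = 0" by (cases "nat r") auto
      with k show "r = 0 \<and> (\<exists>k. v = replicate (4 * j) Sym_a @ blocks k (4 * j))"
        by (cases k) auto
    qed
    finally show ?thesis .
  qed
qed

text \<open>The initial counter 1 forces the first block to have length 1.\<close>

lemma consistent_iff_coding_word:
  "consistent False u 0 \<and> consistent True u 1 \<longleftrightarrow> u \<in> range coding_word"
  using consistent_iff_blocks[of u 0 1] by (auto simp: coding_word_def)

text \<open>This is the number of rotations by \<theta> that state 5 makes before measuring when it
  starts on the last letter of \<open>v\<close>.\<close>

definition trailing :: "ab list \<Rightarrow> nat" where
  "trailing v = length (takeWhile ((=) Sym_a) (rev v))"

lemma trailing_simps [simp]:
  "trailing [] = 0"
  "trailing (v @ [Sym_a]) = Suc (trailing v)"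
  "trailing (v @ Sym_b # v') = trailing v'"
  by (simp_all add: trailing_def takeWhile_tail)

lemma trailing_coding_word: "trailing (coding_word k) = 4 ^ k"
proof -
  have rep: "trailing (replicate m Sym_a) = m" for m
    by (simp add: trailing_def)
  have "trailing (replicate m Sym_a @ blocks k m) = 4 ^ k * m" for m
    by (induction k arbitrary: m) (auto simp: rep)
  from this[of 1] show ?thesis by (simp add: coding_word_def)
qed

section \<open>The machine\<close>

text \<open>
  State 0 returns to the left end-marker and chooses at random between a round that starts in
  state 1 and one that starts in state 2 at angle \<open>sqrt2_angle\<close>, as if a block of length \<open>1/4\<close>
  came first.  States 1 and 2 read the first and the second block of a pair and reject when
  the comparison fails.  A round that gets through makes two random walks, in state 3 from
  the last letter and in state 4 from the first one; only if both end at the far end-marker, and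
  a final coin allows it, state 5 rotates by \<open>\<theta>\<close> for each letter of the last block and
  decides.  Accepting is 6, rejecting is 7.
\<close>

definition goto :: "nat \<Rightarrow> move \<Rightarrow> (qubit_op \<times> nat \<times> move) list" where
  "goto s m = [(Rotation 1 0, s, m)]"

definition walk :: "nat \<Rightarrow> (qubit_op \<times> nat \<times> move) list" where
  "walk s = [(Rotation (sqrt (1 / 2)) 0, s, MoveLeft), (Rotation (sqrt (1 / 2)) 0, s, MoveRight)]"

text \<open>Both outcomes leave angle 0 up to sign, so the next pair of blocks starts with a cleared
  counter.\<close>

definition measure_qubit :: "nat \<Rightarrow> move \<Rightarrow> nat \<Rightarrow> (qubit_op \<times> nat \<times> move) list" where
  "measure_qubit s m s' = [(Projection 1 0 0, s, m), (Projection 1 0 (pi / 2), s', Stay)]"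

text \<open>Projecting in both basis directions erases the old angle, and the weight
  \<open>sqrt (1 / 2)\<close> adds a fair coin. The angle \<open>sqrt2_angle\<close> is the counter
  value 1.\<close>

definition toss :: "(qubit_op \<times> nat \<times> move) list" where
  "toss =
    [(Projection (sqrt (1 / 2)) 0 0, 1, MoveRight),
     (Projection (sqrt (1 / 2)) 0 (pi / 2), 1, MoveRight),
     (Projection (sqrt (1 / 2)) sqrt2_angle 0, 2, MoveRight),
     (Projection (sqrt (1 / 2)) sqrt2_angle (pi / 2), 2, MoveRight)]"

text \<open>The final coin has probability \<open>(1 / 64)^2 = 1 / 4096\<close>; its projections
  also reset the angle for state 5.\<close>

definition decide :: "(qubit_op \<times> nat \<times> move) list" where
  "decide =
    [(Projection (1 / 64) 0 0, 5, MoveLeft), (Projection (1 / 64) 0 (pi / 2), 5, MoveLeft),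
     (Rotation (sqrt (4095 / 4096)) 0, 0, Stay)]"

definition rules :: "real \<Rightarrow> ab qubit_rules" where
  "rules \<theta> s \<sigma> = (case \<sigma> of
     LeftEnd \<Rightarrow>
       if s = 0 then toss else if s = 3 then goto 4 MoveRight
       else if s = 5 then measure_qubit 7 Stay 6 else goto 0 Stay
   | RightEnd \<Rightarrow>
       if s = 0 then goto 0 MoveLeft else if s = 1 then goto 3 MoveLeft
       else if s = 2 then measure_qubit 3 MoveLeft 7 else if s = 4 then decide else goto 0 Stay
   | Letter c \<Rightarrow>
       if s = 0 then goto 0 MoveLeft
       else if s = 1 then
         (if c = Sym_a then [(Rotation 1 (4 * sqrt2_angle), 1, MoveRight)] else goto 2 MoveRight)
       else if s = 2 then
         (if c = Sym_a then [(Rotation 1 (- sqrt2_angle), 2, MoveRight)]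
          else measure_qubit 1 MoveRight 7)
       else if s = 5 then
         (if c = Sym_a then [(Rotation 1 \<theta>, 5, MoveLeft)] else measure_qubit 7 Stay 6)
       else walk s)"

lemmas rules_simps = rules_def goto_def walk_def measure_qubit_def toss_def decide_def

lemma complete_rules: "complete_ops (map fst (rules \<theta> s \<sigma>))"
proof -
  have half: "(cos x)\<^sup>2 / 2 + (sin x)\<^sup>2 / 2 = 1 / 2" for x :: real
    by (simp add: add_divide_distrib[symmetric])
  show ?thesis
    by (cases \<sigma>)
       (auto simp: half rules_simps complete_ops_def op_gram_def power2_eq_square[symmetric]
          power_mult_distrib power_divide)
qed

lemma qubit_automaton_rules: "qubit_automaton 8 {6} {7} (rules \<theta>)"
proof
  fix s :: nat and \<sigma> q r
  show "complete_ops (map fst (rules \<theta> s \<sigma>))" by (rule complete_rules)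
  show "op_scale q > 0" if "(q, r) \<in> set (rules \<theta> s \<sigma>)"
    using that by (cases \<sigma>) (auto simp: rules_simps split: if_splits)
next
  fix s s' :: nat and \<sigma> q m
  show "s' < 8" if "s < 8" "(q, s', m) \<in> set (rules \<theta> s \<sigma>)"
    using that by (cases \<sigma>) (auto simp: rules_simps split: if_splits)
next
  fix s s' :: nat and q
  show "(q, s', MoveLeft) \<notin> set (rules \<theta> s LeftEnd)"
    by (auto simp: rules_simps)
  show "(q, s', MoveRight) \<notin> set (rules \<theta> s RightEnd)"
    by (auto simp: rules_simps)
qed auto

definition machine :: "real \<Rightarrow> ab qcfa" where
  "machine \<theta> = qubit_machine 8 {6} {7} (rules \<theta>)"

section \<open>Reachable head positions and certificates for the machine\<close>

definition head_inv :: "ab list \<Rightarrow> nat \<Rightarrow> nat \<Rightarrow> bool" where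
  "head_inv w s h \<longleftrightarrow> s < 8 \<and> h \<le> Suc (length w) \<and> (s = 1 \<or> s = 2 \<longrightarrow> 1 \<le> h) \<and>
     (s = 5 \<longrightarrow> h \<le> length w)"

lemma tape_cases:
  assumes "h \<le> Suc (length w)"
  obtains "h = 0" "tape w h = LeftEnd"
  | c where "1 \<le> h" "h \<le> length w" "w ! (h - 1) = c" "tape w h = Letter c"
  | "h = Suc (length w)" "tape w h = RightEnd"
proof -
  consider "h = 0" | "1 \<le> h" "h \<le> length w" | "h = Suc (length w)"
    using assms by linarith
  then show ?thesis
    by cases (simp_all add: tape_def that)
qed

text \<open>States 1 and 2 are entered only by moves to the right and state 5 only by moves to the
  left, so certificates do not have to cover them at the opposite end-marker.\<close>

lemma head_inv_step:
  assumes "head_inv w s h" "(q, s', m) \<in> set (rules \<theta> s (tape w h))"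
  shows "head_inv w s' (move_head m h)"
proof -
  have "h \<le> Suc (length w)" using assms by (simp add: head_inv_def)
  then show ?thesis
    using assms by (cases rule: tape_cases) (auto simp: head_inv_def rules_simps split: if_splits)
qed

text \<open>
  A certificate bounds expected values of a run from above, state by state: the accumulated
  cost \<open>\<kappa>\<close> per step plus a final payoff \<open>p\<close> for accepting and \<open>q\<close> for rejecting.
\<close>

locale certificate =
  fixes \<theta> :: real and w :: "ab list" and \<kappa> p q :: real
    and V0 V3 V4 :: "nat \<Rightarrow> real" and V1 V2 V5 :: "nat \<Rightarrow> real \<Rightarrow> real"
  assumes payoff: "0 \<le> p" "0 \<le> q"
    and nonneg: "h \<le> Suc (length w) \<Longrightarrow> 0 \<le> V0 h" "h \<le> Suc (length w) \<Longrightarrow> 0 \<le> V1 h x"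
      "h \<le> Suc (length w) \<Longrightarrow> 0 \<le> V2 h x" "h \<le> Suc (length w) \<Longrightarrow> 0 \<le> V3 h"
      "h \<le> Suc (length w) \<Longrightarrow> 0 \<le> V4 h" "h \<le> Suc (length w) \<Longrightarrow> 0 \<le> V5 h x"
    and periodic: "V1 h (x + pi) = V1 h x" "V2 h (x + pi) = V2 h x" "V5 h (x + pi) = V5 h x"
    and start: "\<kappa> + (V1 1 0 + V2 1 sqrt2_angle) / 2 \<le> V0 0"
    and return: "1 \<le> h \<Longrightarrow> h \<le> Suc (length w) \<Longrightarrow> \<kappa> + V0 (h - 1) \<le> V0 h"
    and first_a: "1 \<le> h \<Longrightarrow> h \<le> length w \<Longrightarrow> w ! (h - 1) = Sym_a \<Longrightarrow>
      \<kappa> + V1 (h + 1) (x + 4 * sqrt2_angle) \<le> V1 h x"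
    and first_b: "1 \<le> h \<Longrightarrow> h \<le> length w \<Longrightarrow> w ! (h - 1) = Sym_b \<Longrightarrow> \<kappa> + V2 (h + 1) x \<le> V1 h x"
    and first_end: "\<kappa> + V3 (length w) \<le> V1 (Suc (length w)) x"
    and second_a: "1 \<le> h \<Longrightarrow> h \<le> length w \<Longrightarrow> w ! (h - 1) = Sym_a \<Longrightarrow>
      \<kappa> + V2 (h + 1) (x - sqrt2_angle) \<le> V2 h x"
    and second_b: "1 \<le> h \<Longrightarrow> h \<le> length w \<Longrightarrow> w ! (h - 1) = Sym_b \<Longrightarrow>
      \<kappa> + ((cos x)\<^sup>2 * V1 (h + 1) 0 + (sin x)\<^sup>2 * q) \<le> V2 h x"
    and second_end: "\<kappa> + ((cos x)\<^sup>2 * V3 (length w) + (sin x)\<^sup>2 * q) \<le> V2 (Suc (length w)) x"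
    and walk3: "1 \<le> h \<Longrightarrow> h \<le> length w \<Longrightarrow> \<kappa> + (V3 (h - 1) + V3 (h + 1)) / 2 \<le> V3 h"
    and walk3_ends: "\<kappa> + V4 1 \<le> V3 0" "\<kappa> + V0 (Suc (length w)) \<le> V3 (Suc (length w))"
    and walk4: "1 \<le> h \<Longrightarrow> h \<le> length w \<Longrightarrow> \<kappa> + (V4 (h - 1) + V4 (h + 1)) / 2 \<le> V4 h"
    and walk4_ends: "\<kappa> + V0 0 \<le> V4 0"
      "\<kappa> + (V5 (length w) 0 / 4096 + (4095 / 4096) * V0 (Suc (length w))) \<le> V4 (Suc (length w))"
    and last_a: "1 \<le> h \<Longrightarrow> h \<le> length w \<Longrightarrow> w ! (h - 1) = Sym_a \<Longrightarrow>
      \<kappa> + V5 (h - 1) (x + \<theta>) \<le> V5 h x"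
    and last_other: "h = 0 \<or> h \<le> length w \<and> w ! (h - 1) = Sym_b \<Longrightarrow>
      \<kappa> + ((cos x)\<^sup>2 * q + (sin x)\<^sup>2 * p) \<le> V5 h x"
begin

sublocale qubit_automaton 8 "{6}" "{7}" "rules \<theta>"
  by (rule qubit_automaton_rules)

definition potential :: "nat \<Rightarrow> nat \<Rightarrow> real \<Rightarrow> real" where
  "potential s h x = (if s = 0 then V0 h else if s = 1 then V1 h x else if s = 2 then V2 h x
     else if s = 3 then V3 h else if s = 4 then V4 h else if s = 5 then V5 h x
     else if s = 6 then p else q)"

lemma potential_nonneg: "head_inv w s h \<Longrightarrow> 0 \<le> potential s h x"
  by (simp add: nonneg payoff potential_def head_inv_def)

text \<open>These equations absorb the shift by \<open>pi\<close> after a projection with negative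
  amplitude.\<close>

lemma periodic_pi: "V1 h pi = V1 h 0" "V2 h (sqrt2_angle + pi) = V2 h sqrt2_angle" "V5 h pi = V5 h 0"
  using periodic(1)[of h 0] periodic(2)[of h sqrt2_angle] periodic(3)[of h 0] by simp_all

lemma potential_step:
  assumes inv: "head_inv w s h" and s: "s \<notin> {6} \<union> {7}"
  shows "\<kappa> + (\<Sum>(r, s', m)\<leftarrow>rules \<theta> s (tape w h).
      op_prob r x * potential s' (move_head m h) (op_angle r x)) \<le> potential s h x"
proof -
  have h: "h \<le> Suc (length w)" and s_cases: "s = 0 \<or> s = 1 \<or> s = 2 \<or> s = 3 \<or> s = 4 \<or> s = 5"
    using inv s by (auto simp: head_inv_def)
  have cs: "(cos x)\<^sup>2 + (sin x)\<^sup>2 = 1" by simp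
  \<comment> \<open>Complementary projections with the same successor merge into a classical
    transition.\<close>
  have quarter: "(cos x)\<^sup>2 * a + ((sin x)\<^sup>2 * a + b) = a + b" for a b :: real
    using cs by (metis add.assoc distrib_right mult_1)
  have quarter': "(cos x)\<^sup>2 * a + (sin x)\<^sup>2 * a = a" for a :: real
    using quarter[of a 0] by simp
  have halves: "(cos x)\<^sup>2 * a / 2 + ((sin x)\<^sup>2 * a / 2 + ((cos x)\<^sup>2 * b / 2 + (sin x)\<^sup>2 * b / 2)) =
      (a + b) / 2" for a b :: real
  proof -
    have "(a + b) / 2 = ((cos x)\<^sup>2 * a + (sin x)\<^sup>2 * a + ((cos x)\<^sup>2 * b + (sin x)\<^sup>2 * b)) / 2"
      unfolding quarter' ..
    then show ?thesis by (simp add: add_divide_distrib)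
  qed
  have parts: "(cos x)\<^sup>2 * a / 4096 + ((sin x)\<^sup>2 * a / 4096 + b) = a / 4096 + b" for a b :: real
    using quarter[of "a / 4096" b] by simp
  note simps = rules_simps potential_def periodic_pi power_mult_distrib cos_diff sin_diff quarter
    power_divide
  from h show ?thesis
  proof (cases rule: tape_cases)
    case 1
    consider "s = 0" | "s = 3" | "s = 4" | "s = 5" using s_cases inv 1 by (auto simp: head_inv_def)
    then show ?thesis
    proof cases
      assume "s = 0"
      then show ?thesis using start 1 by (simp add: simps halves)
    next
      assume "s = 3" then show ?thesis using walk3_ends 1 by (simp add: simps)
    next
      assume "s = 4" then show ?thesis using walk4_ends 1 by (simp add: simps)
    next
      assume "s = 5" then show ?thesis using last_other[of h x] 1 by (simp add: simps)
    qed
  next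
    case (2 c)
    from s_cases show ?thesis
    proof (elim disjE)
      assume "s = 0" then show ?thesis using return[of h] 2 by (simp add: simps)
    next
      assume "s = 1" then show ?thesis
        using first_a[of h x] first_b[of h x] 2 by (cases c) (simp_all add: simps)
    next
      assume "s = 2" then show ?thesis
        using second_a[of h x] second_b[of h x] 2 by (cases c) (simp_all add: simps)
    next
      assume "s = 3" then show ?thesis using walk3[of h] 2 by (simp add: simps add_divide_distrib)
    next
      assume "s = 4" then show ?thesis using walk4[of h] 2 by (simp add: simps add_divide_distrib)
    next
      assume "s = 5" then show ?thesis
        using last_a[of h x] last_other[of h x] 2 by (cases c) (simp_all add: simps)
    qed
  next
    case 3
    consider "s = 0" | "s = 1" | "s = 2" | "s = 3" | "s = 4"
      using s_cases inv 3 by (auto simp: head_inv_def)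
    then show ?thesis
    proof cases
      assume "s = 0" then show ?thesis using return[of h] 3 by (simp add: simps)
    next
      assume "s = 1" then show ?thesis using first_end 3 by (simp add: simps)
    next
      assume "s = 2" then show ?thesis using second_end 3 by (simp add: simps)
    next
      assume "s = 3" then show ?thesis using walk3_ends 3 by (simp add: simps)
    next
      assume "s = 4" then show ?thesis using walk4_ends 3 by (simp add: simps parts)
    qed
  qed
qed

lemma state_prob_le:
  assumes "\<kappa> = 0" "T \<subseteq> {6, 7}" "6 \<in> T \<Longrightarrow> 1 \<le> p" "7 \<in> T \<Longrightarrow> 1 \<le> q"
  shows "state_prob (machine \<theta>) w t T \<le> V0 0"
proof -
  have "measure_pmf.prob (run M w t (0, 0, qubit 0)) {c. fst c \<in> T} \<le> potential 0 0 0"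
  proof (rule run_prob_le[where I = "head_inv w" and V = potential])
    show "1 \<le> potential s h x" if "s \<in> T" for s h x
      using that assms(2-4) by (cases "s = 6") (auto simp: potential_def)
    show "(\<Sum>(r, s', m)\<leftarrow>rules \<theta> s (tape w h).
        op_prob r x * potential s' (move_head m h) (op_angle r x)) \<le> potential s h x"
      if "head_inv w s h" "s \<notin> {6} \<union> {7}" for s h x
      using potential_step[OF that, of x] assms(1) by simp
    show "T \<subseteq> {6} \<union> {7}" using assms(2) by auto
    show "head_inv w 0 0" by (simp add: head_inv_def)
  qed (erule (1) head_inv_step, erule potential_nonneg)
  then show ?thesis
    by (simp add: state_prob_def machine_def init_config_M potential_def)
qed

lemma running_sum_le:
  assumes "\<kappa> = 1" "\<And>h x. V1 h x = V1 h 0" "\<And>h x. V2 h x = V2 h 0" "\<And>h x. V5 h x = V5 h 0"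
  shows "(\<Sum>t<k. state_prob (machine \<theta>) w t (- halting (machine \<theta>))) \<le> V0 0"
proof -
  have V: "potential s h x = potential s h 0" for s h x
    using assms by (auto simp: potential_def)
  have "(\<Sum>t<k. measure_pmf.prob (run M w t (0, 0, qubit 0)) {c. fst c \<in> - halting M}) \<le> potential 0 0 0"
  proof (rule run_time_le[where I = "head_inv w" and V = "\<lambda>s h. potential s h 0"])
    show "1 + (\<Sum>(r, s', m)\<leftarrow>rules \<theta> s (tape w h). op_prob r x * potential s' (move_head m h) 0)
        \<le> potential s h 0" if "head_inv w s h" "s \<notin> {6} \<union> {7}" for s h x
      using potential_step[OF that, of x] assms(1) by (simp add: V[of _ _ "op_angle _ _"] V[of _ _ x])
    show "head_inv w 0 0" by (simp add: head_inv_def)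
  qed (erule (1) head_inv_step, erule potential_nonneg)
  then show ?thesis
    by (simp add: state_prob_def machine_def init_config_M potential_def)
qed

end

section \<open>Three certificates\<close>

text \<open>
  With \<open>N\<close> the position of the right end-marker, the final coin is reached and succeeds in a round
  with probability \<open>1 / (4096 N\<^sup>2)\<close> when no test fails.
\<close>

lemma certificate_time:
  fixes w :: "ab list" and N H :: real
  defines "N \<equiv> real (length w) + 1"
  defines "H \<equiv> 20480 * N ^ 3"
  shows "certificate \<theta> w 1 0 0 (\<lambda>h. H + h)
    (\<lambda>h. H + N + 2 - 5 * N\<^sup>2 + 5 * N * h + h * (N - h)) (\<lambda>h. H + 1 + (1 - 5 * N\<^sup>2) * h + h * (N - h))
    (\<lambda>h x. H - 2 * N + 2 - h) (\<lambda>h x. H - 2 * N + 2 - h) (\<lambda>h x. real h + 1)"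
proof -
  have N: "1 \<le> N" by (simp add: N_def)
  have N2: "N \<le> N\<^sup>2" using power_increasing[of 1 2 N] N by simp
  have N3: "N\<^sup>2 \<le> N ^ 3" using N by (simp add: power_increasing)
  have h: "real h \<le> N" "0 \<le> real h * (N - real h)" if "h \<le> Suc (length w)" for h
    using that by (auto simp: N_def)
  have V1: "0 \<le> H - 2 * N + 2 - real h" if "h \<le> Suc (length w)" for h
    using h[OF that] N N2 N3 unfolding H_def by linarith
  have V3: "0 \<le> H + N + 2 - 5 * N\<^sup>2 + 5 * N * real h + real h * (N - real h)"
    if "h \<le> Suc (length w)" for h
    using h[OF that] N N2 N3 mult_nonneg_nonneg[of N "real h"] unfolding H_def by linarith
  have V4: "0 \<le> H + 1 + (1 - 5 * N\<^sup>2) * real h + real h * (N - real h)"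
    if "h \<le> Suc (length w)" for h
  proof -
    have "N\<^sup>2 * real h \<le> N\<^sup>2 * N" using h[OF that] by (intro mult_left_mono) auto
    then have "5 * (N\<^sup>2 * real h) \<le> H" using N by (simp add: H_def power3_eq_cube power2_eq_square)
    then show ?thesis using h[OF that] by (simp add: left_diff_distrib mult.assoc)
  qed
  have last: "real (Suc (length w)) = N" by (simp add: N_def)
  \<comment> \<open>A rejection ends the run at no further cost, so a test can only lower the
    expected remaining time.\<close>
  have test: "1 + ((cos x)\<^sup>2 * a + (sin x)\<^sup>2 * 0) \<le> b" if "0 \<le> a" "1 + a \<le> b" for a b x :: real
  proof -
    have "(cos x)\<^sup>2 * a \<le> a" using that(1) by (intro mult_left_le_one_le) (auto simp: abs_square_le_1)
    then show ?thesis using that(2) by simp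
  qed
  show ?thesis
  proof
    show "1 + (H - 2 * N + 2 - real 1 + (H - 2 * N + 2 - real 1)) / 2 \<le> H + real 0"
      using N by (simp add: field_simps)
  next
    fix h x
    assume h: "1 \<le> h" "h \<le> length w" "w ! (h - 1) = Sym_b"
    show "1 + ((cos x)\<^sup>2 * (H - 2 * N + 2 - real (h + 1)) + (sin x)\<^sup>2 * 0) \<le> H - 2 * N + 2 - real h"
      using V1[of "h + 1"] h(2) by (intro test) auto
  next
    fix x
    have eq: "H + N + 2 - 5 * N\<^sup>2 + 5 * N * real (length w) + real (length w) * (N - real (length w)) =
        H - 3 * N + 1"
      by (simp add: N_def algebra_simps power2_eq_square)
    show "1 + ((cos x)\<^sup>2 * (H + N + 2 - 5 * N\<^sup>2 + 5 * N * real (length w) +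
        real (length w) * (N - real (length w))) + (sin x)\<^sup>2 * 0) \<le> H - 2 * N + 2 - real (Suc (length w))"
      using V3[of "length w"] unfolding last eq by (intro test) auto
  next
    fix h assume h: "1 \<le> h" "h \<le> length w"
    then have h1: "real (h - 1) = real h - 1" by (simp add: of_nat_diff)
    \<comment> \<open>The term \<open>h * (N - h)\<close> is the expected duration of a fair walk
      stopped at 0 and \<open>N\<close>, and it pays for the steps; the affine terms are
      harmonic.\<close>
    show "1 + (H + N + 2 - 5 * N\<^sup>2 + 5 * N * real (h - 1) + real (h - 1) * (N - real (h - 1)) +
        (H + N + 2 - 5 * N\<^sup>2 + 5 * N * real (h + 1) + real (h + 1) * (N - real (h + 1)))) / 2
        \<le> H + N + 2 - 5 * N\<^sup>2 + 5 * N * real h + real h * (N - real h)"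
      unfolding h1 by (simp add: field_simps)
    show "1 + (H + 1 + (1 - 5 * N\<^sup>2) * real (h - 1) + real (h - 1) * (N - real (h - 1)) +
        (H + 1 + (1 - 5 * N\<^sup>2) * real (h + 1) + real (h + 1) * (N - real (h + 1)))) / 2
        \<le> H + 1 + (1 - 5 * N\<^sup>2) * real h + real h * (N - real h)"
      unfolding h1 by (simp add: field_simps)
  next
    show "1 + (H + 1 + (1 - 5 * N\<^sup>2) * real 1 + real 1 * (N - real 1))
        \<le> H + N + 2 - 5 * N\<^sup>2 + 5 * N * real 0 + real 0 * (N - real 0)"
      by simp
    show "1 + (H + real (Suc (length w)))
        \<le> H + N + 2 - 5 * N\<^sup>2 + 5 * N * real (Suc (length w)) +
          real (Suc (length w)) * (N - real (Suc (length w)))"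
      unfolding last by (simp add: power2_eq_square)
    \<comment> \<open>This fixes \<open>H\<close>: the coin releases \<open>H / 4096\<close>, which
      must equal the deficit \<open>5 * N ^ 3\<close> of the potential of state 4 here.\<close>
    show "1 + ((real (length w) + 1) / 4096 + 4095 / 4096 * (H + real (Suc (length w))))
        \<le> H + 1 + (1 - 5 * N\<^sup>2) * real (Suc (length w)) +
          real (Suc (length w)) * (N - real (Suc (length w)))"
      unfolding last N_def[symmetric] by (simp add: H_def power2_eq_square power3_eq_cube field_simps)
  next
    show "1 + (H + N + 2 - 5 * N\<^sup>2 + 5 * N * real (length w) + real (length w) * (N - real (length w)))
        \<le> H - 2 * N + 2 - real (Suc (length w))"
      by (simp add: N_def algebra_simps power2_eq_square)
  next
    fix h assume "h \<le> Suc (length w)"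
    then show "0 \<le> H + N + 2 - 5 * N\<^sup>2 + 5 * N * real h + real h * (N - real h)"
      by (rule V3)
  next
    fix h assume "h \<le> Suc (length w)"
    then show "0 \<le> H + 1 + (1 - 5 * N\<^sup>2) * real h + real h * (N - real h)"
      by (rule V4)
  next
    show "0 \<le> H + real h" for h using N by (simp add: H_def)
  qed (use N V1 in \<open>simp_all add: of_nat_diff\<close>)
qed

text \<open>Acceptance has probability at most 1/8. Reaching state 5 is valued as acceptance, and
  the walks have linear, hence harmonic, potentials; \<open>K\<close> is the value of a round that
  has passed all tests.\<close>

lemma certificate_inconsistent:
  fixes w :: "ab list" and N K :: real
  assumes "w \<notin> range coding_word"
  defines "N \<equiv> real (length w) + 1"
  defines "K \<equiv> 1 / 8 + 1 / (4096 * N\<^sup>2)"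
  shows "certificate \<theta> w 0 1 0 (\<lambda>h. 1 / 8) (\<lambda>h. 1 / 8 + (N - h) / (4096 * N\<^sup>2))
    (\<lambda>h. 1 / 8 + h / (4096 * N)) (\<lambda>h x. K * survival False (drop (h - 1) w) x)
    (\<lambda>h x. K * survival True (drop (h - 1) w) x) (\<lambda>h x. 1)"
proof -
  have N: "1 \<le> N" by (simp add: N_def)
  have K: "0 \<le> K" by (simp add: K_def)
  have drop: "drop (h - Suc 0) w = w ! (h - Suc 0) # drop h w" if "1 \<le> h" "h \<le> length w" for h
    using that Cons_nth_drop_Suc[of "h - 1" w] by simp
  \<comment> \<open>With initial counter 0 or 1 the counter stays within \<open>4 * N\<close>, so
    the phase that is inconsistent loses at least
    \<open>1 / (16 * (4 * N)^2) = 1 / (256 * N^2)\<close>.\<close>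
  have D: "real_of_int (4 * (1 + int (length w))) = 4 * N"
    by (simp add: N_def)
  have "survival False w 0 + survival True w sqrt2_angle \<le> 2 - 1 / (256 * N\<^sup>2)"
  proof (cases "consistent False w 0")
    case True
    then have "\<not> consistent True w 1"
      using assms(1) consistent_iff_coding_word by blast
    from survival_inconsistent[OF this, of "4 * (1 + int (length w))", unfolded D]
    show ?thesis using survival_bounds(2)[of False w 0] by (simp add: power_mult_distrib)
  next
    case False
    from survival_inconsistent[OF this, of "4 * (1 + int (length w))", unfolded D]
    show ?thesis using survival_bounds(2)[of True w sqrt2_angle] by (simp add: power_mult_distrib)
  qed
  then have "K * (survival False w 0 + survival True w sqrt2_angle) \<le> K * (2 - 1 / (256 * N\<^sup>2))"
    using K by (rule mult_left_mono)
  also have "\<dots> \<le> 1 / 4"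
  proof -
    \<comment> \<open>The coin 1/4096 makes the linear terms cancel: the gain
      \<open>2 * t / 4096\<close> equals the loss \<open>t / (8 * 256)\<close>.\<close>
    define t where "t = 1 / N\<^sup>2"
    have "K * (2 - 1 / (256 * N\<^sup>2)) = (1 / 8 + t / 4096) * (2 - t / 256)"
      by (simp add: K_def t_def mult.commute)
    also have "\<dots> = 1 / 4 - t * t / 1048576"
      by (simp add: field_simps)
    finally show ?thesis by simp
  qed
  finally have start: "(K * survival False w 0 + K * survival True w sqrt2_angle) / 2 \<le> 1 / 8"
    by (simp add: algebra_simps)
  show ?thesis
  proof
    show "0 + (K * survival False (drop (1 - 1) w) 0 + K * survival True (drop (1 - 1) w) sqrt2_angle) / 2
        \<le> 1 / 8"
      using start by simp
  next
    fix x
    show "0 + (1 / 8 + (N - real (length w)) / (4096 * N\<^sup>2)) \<le>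
        K * survival False (drop (Suc (length w) - 1) w) x"
      by (simp add: K_def N_def)
    show "0 + ((cos x)\<^sup>2 * (1 / 8 + (N - real (length w)) / (4096 * N\<^sup>2)) + (sin x)\<^sup>2 * 0)
        \<le> K * survival True (drop (Suc (length w) - 1) w) x"
      by (simp add: K_def N_def)
  next
    show "0 + (1 / 8 + real 1 / (4096 * N)) \<le> 1 / 8 + (N - real 0) / (4096 * N\<^sup>2)"
      using N by (simp add: power2_eq_square)
    show "0 + 1 / 8 \<le> 1 / 8 + (N - real (Suc (length w))) / (4096 * N\<^sup>2)"
      by (simp add: N_def)
    have last: "real (Suc (length w)) = N" by (simp add: N_def)
    show "0 + (1 / 4096 + 4095 / 4096 * (1 / 8)) \<le> 1 / 8 + real (Suc (length w)) / (4096 * N)"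
      unfolding last using N by simp
  next
    fix h assume h: "1 \<le> h" "h \<le> length w"
    show "0 + (1 / 8 + (N - real (h - 1)) / (4096 * N\<^sup>2) + (1 / 8 + (N - real (h + 1)) / (4096 * N\<^sup>2))) / 2
        \<le> 1 / 8 + (N - real h) / (4096 * N\<^sup>2)"
      using h by (simp add: of_nat_diff diff_divide_distrib add_divide_distrib)
    show "0 + (1 / 8 + real (h - 1) / (4096 * N) + (1 / 8 + real (h + 1) / (4096 * N))) / 2
        \<le> 1 / 8 + real h / (4096 * N)"
      using h by (simp add: of_nat_diff diff_divide_distrib add_divide_distrib)
  next
    fix h x
    show "0 + ((cos x)\<^sup>2 * 0 + (sin x)\<^sup>2 * 1) \<le> (1 :: real)"
      by (simp add: abs_square_le_1)
  next
    fix h assume "h \<le> Suc (length w)"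
    then show "0 \<le> 1 / 8 + (N - real h) / (4096 * N\<^sup>2)" "0 \<le> 1 / 8 + real h / (4096 * N)"
      using N by (simp_all add: N_def)
  qed (simp_all add: K survival_bounds survival_add_pi drop)
qed

text \<open>The payoffs \<open>p\<close> and \<open>q\<close> select the verdict to be bounded. The
  comparison potentials are 1/4 where all remaining tests are sure to pass, as in every round on a
  coding word, and rise to 1 as survival falls to 0. The potential of state 5 is the exact expected
  payoff of its measurement.\<close>

lemma certificate_coding_word:
  fixes \<theta> p q :: real and k :: nat and w :: "ab list"
  defines "w \<equiv> coding_word k"
  assumes p: "0 \<le> p" "p \<le> 1" and q: "0 \<le> q" "q \<le> 1"
    and final: "(cos (4 ^ k * \<theta>))\<^sup>2 * q + (sin (4 ^ k * \<theta>))\<^sup>2 * p \<le> 1 / 4"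
  shows "certificate \<theta> w 0 p q (\<lambda>h. 1 / 4) (\<lambda>h. 1 / 4) (\<lambda>h. 1 / 4)
    (\<lambda>h x. 1 - 3 / 4 * survival False (drop (h - 1) w) x)
    (\<lambda>h x. 1 - 3 / 4 * survival True (drop (h - 1) w) x)
    (\<lambda>h x. (cos (x + trailing (take h w) * \<theta>))\<^sup>2 * q + (sin (x + trailing (take h w) * \<theta>))\<^sup>2 * p)"
proof -
  have consistent: "consistent False w 0" "consistent True w 1"
    using consistent_iff_coding_word[of w] by (auto simp: w_def)
  have drop: "drop (h - Suc 0) w = w ! (h - Suc 0) # drop h w" if "1 \<le> h" "h \<le> length w" for h
    using that Cons_nth_drop_Suc[of "h - 1" w] by simp
  have take: "take h w = take (h - 1) w @ [w ! (h - 1)]" if "1 \<le> h" "h \<le> length w" for h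
    using that take_Suc_conv_app_nth[of "h - 1" w] by simp
  have test: "(cos x)\<^sup>2 + (sin x)\<^sup>2 * q \<le> 1" for x
    using mult_left_le[OF q(2) zero_le_power2[of "sin x"]] sin_cos_squared_add[of x] by linarith
  have bounds: "3 * survival c v x \<le> 4" for c v x
    using survival_bounds(2)[of c v x] by linarith
  show ?thesis
  proof
    show "0 + (1 - 3 / 4 * survival False (drop (1 - 1) w) 0 +
        (1 - 3 / 4 * survival True (drop (1 - 1) w) sqrt2_angle)) / 2 \<le> 1 / 4"
      using survival_consistent[OF consistent(1)] survival_consistent[OF consistent(2)] by simp
  next
    fix h x assume h: "1 \<le> h" "h \<le> length w" "w ! (h - 1) = Sym_b"
    show "0 + ((cos x)\<^sup>2 * (1 - 3 / 4 * survival False (drop (h + 1 - 1) w) 0) + (sin x)\<^sup>2 * q)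
        \<le> 1 - 3 / 4 * survival True (drop (h - 1) w) x"
      using test[of x] h by (simp add: drop algebra_simps)
  next
    fix x
    show "0 + ((cos x)\<^sup>2 * (1 / 4) + (sin x)\<^sup>2 * q) \<le>
        1 - 3 / 4 * survival True (drop (Suc (length w) - 1) w) x"
      using test[of x] by simp
  next
    have "((cos (0 + real (trailing (take (length w) w)) * \<theta>))\<^sup>2 * q +
        (sin (0 + real (trailing (take (length w) w)) * \<theta>))\<^sup>2 * p) \<le> 1 / 4"
      using final by (simp add: w_def trailing_coding_word)
    \<comment> \<open>The coin mixes the decision with another round, each worth at most
      1/4.\<close>
    moreover have "a / 4096 + 4095 / 4096 * (1 / 4) \<le> 1 / 4" if "a \<le> 1 / 4" for a :: real
      using that by simp
    ultimately show "0 + (((cos (0 + real (trailing (take (length w) w)) * \<theta>))\<^sup>2 * q +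
        (sin (0 + real (trailing (take (length w) w)) * \<theta>))\<^sup>2 * p) / 4096 + 4095 / 4096 * (1 / 4)) \<le> 1 / 4"
      unfolding add_0_left by blast
  next
    fix h x assume h: "1 \<le> h" "h \<le> length w" "w ! (h - 1) = Sym_a"
    have "x + \<theta> + real (trailing (take (h - 1) w)) * \<theta> = x + real (trailing (take h w)) * \<theta>"
      using h by (simp add: take algebra_simps)
    then show "0 + ((cos (x + \<theta> + real (trailing (take (h - 1) w)) * \<theta>))\<^sup>2 * q +
        (sin (x + \<theta> + real (trailing (take (h - 1) w)) * \<theta>))\<^sup>2 * p)
      \<le> (cos (x + real (trailing (take h w)) * \<theta>))\<^sup>2 * q + (sin (x + real (trailing (take h w)) * \<theta>))\<^sup>2 * p"
      by (simp only: add_0_left order_refl)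
  next
    fix h x assume h: "h = 0 \<or> h \<le> length w \<and> w ! (h - 1) = Sym_b"
    have "trailing (take h w) = 0"
    proof (cases "h = 0")
      case False
      then show ?thesis using h trailing_simps(3)[of "take (h - 1) w" "[]"] by (simp add: take)
    qed simp
    then show "0 + ((cos x)\<^sup>2 * q + (sin x)\<^sup>2 * p)
      \<le> (cos (x + real (trailing (take h w)) * \<theta>))\<^sup>2 * q + (sin (x + real (trailing (take h w)) * \<theta>))\<^sup>2 * p"
      by simp
  next
    fix h x
    show "(cos (x + pi + real (trailing (take h w)) * \<theta>))\<^sup>2 * q + (sin (x + pi + real (trailing (take h w)) * \<theta>))\<^sup>2 * p
      = (cos (x + real (trailing (take h w)) * \<theta>))\<^sup>2 * q + (sin (x + real (trailing (take h w)) * \<theta>))\<^sup>2 * p"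
      using cos_periodic_pi[of "x + real (trailing (take h w)) * \<theta>"]
        sin_periodic_pi[of "x + real (trailing (take h w)) * \<theta>"] by (simp add: ac_simps)
  qed (simp_all add: p q bounds survival_add_pi drop)
qed

theorem theorem1:
  fixes L :: "'a::finite list set"
  shows "\<exists>L' :: ab list set.
           turing_equivalent L' L \<and>
           (\<exists>M :: ab qcfa. is_2qcfa M \<and> recognizes_bounded_error M L' \<and> polynomial_expected_time M)"
proof (intro exI conjI)
  define X where "X = word_code ` L"
  define \<theta> where "\<theta> = set_angle X"
  let ?M = "machine \<theta>"
  show "turing_equivalent (coding_word ` X) L"
    unfolding X_def by (rule turing_equivalent_coding_words)
  show "is_2qcfa ?M"
    unfolding machine_def by (rule qubit_automaton.is_2qcfa_M[OF qubit_automaton_rules])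
  have states: "acc_states ?M = {6}" "rej_states ?M = {7}" "halting ?M = {6, 7}"
    by (auto simp: machine_def qubit_machine_def halting_def)
  have time: "(\<Sum>t<k. state_prob ?M w t (- halting ?M)) \<le> 20480 * (real (length w) + 1) ^ 3" for w k
    using certificate.running_sum_le[OF certificate_time[of \<theta> w]] by simp
  note running = state_prob_running_tendsto[OF time]
  show "polynomial_expected_time ?M"
    unfolding polynomial_expected_time_def
  proof (intro exI allI)
    fix w
    have "expected_steps ?M w \<le> ennreal (20480 * (real (length w) + 1) ^ 3)"
      by (rule expected_steps_le[OF time])
    also have "20480 * (real (length w) + 1) ^ 3 = real (poly ([:20480:] * [:1, 1:] ^ 3) (length w))"
      by (simp add: poly_power add.commute)
    finally show "expected_steps ?M w \<le> of_nat (poly ([:20480:] * [:1, 1:] ^ 3) (length w))"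
      by (simp add: ennreal_of_nat_eq_real_of_nat)
  qed
  have reject: "3 / 4 \<le> reject_prob ?M w" if "\<And>t. state_prob ?M w t {6} \<le> 1 / 4" for w
    using halting_prob_complement[OF that running, of "{7}"]
    by (simp add: reject_prob_def states(2,3) insert_commute)
  have accept: "3 / 4 \<le> accept_prob ?M w" if "\<And>t. state_prob ?M w t {7} \<le> 1 / 4" for w
    using halting_prob_complement[OF that running, of "{6}"]
    by (simp add: accept_prob_def states(1,3))
  show "recognizes_bounded_error ?M (coding_word ` X)"
    unfolding recognizes_bounded_error_def
  proof (intro exI[of _ "1 / 4"] conjI ballI allI impI)
    fix w assume "w \<in> coding_word ` X"
    then obtain k where k: "w = coding_word k" "k \<in> X" by auto
    have "(cos (4 ^ k * \<theta>))\<^sup>2 * 1 + (sin (4 ^ k * \<theta>))\<^sup>2 * 0 \<le> 1 / 4"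
      using sin_set_angle(1)[OF k(2)] by (simp add: \<theta>_def cos_squared_eq)
    from certificate.state_prob_le[OF certificate_coding_word[OF _ _ _ _ this], of "{7}"]
    show "1 - 1 / 4 \<le> accept_prob ?M w"
      using accept[of w] by (simp add: k)
  next
    fix w assume w: "w \<notin> coding_word ` X"
    have "state_prob ?M w t {6} \<le> 1 / 4" for t
    \<comment> \<open>A coding word with index outside \<open>X\<close> can be accepted only by the
      measurement of the digit; any other word must survive the comparisons.\<close>
    proof (cases "w \<in> range coding_word")
      case True
      then obtain k where k: "w = coding_word k" by auto
      have "(cos (4 ^ k * \<theta>))\<^sup>2 * 0 + (sin (4 ^ k * \<theta>))\<^sup>2 * 1 \<le> 1 / 4"
        using sin_set_angle(2)[of k X] w by (auto simp: \<theta>_def k)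
      from certificate.state_prob_le[OF certificate_coding_word[OF _ _ _ _ this], of "{6}"]
      show ?thesis by (simp add: k)
    next
      case False
      from certificate.state_prob_le[OF certificate_inconsistent[OF this, of \<theta>], of "{6}" t]
      show ?thesis by simp
    qed
    then show "1 - 1 / 4 \<le> reject_prob ?M w"
      using reject[of w] by simp
  qed simp
qed

end
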